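(* The field $\mathcal{M}_s(\mathbb{H})$ of slice preserving semiregular functions in $\mathbb{H}$ is the quotient field of the integral domain $\mathcal{O}_s(\mathbb{H})$ of slice preserving regular functions in $\mathbb{H}$. Equivalently, for every slice preserving semiregular function $h$ in $\mathbb{H}$, there exist two slice preserving regular functions $f$ and $g$ in $\mathbb{H}$ without common zeros in $\mathbb{H}$ such that $h=\dfrac{f}{g}$.
   Context: $\mathbb{H}$ denotes the real quaternions, $\mathbb{S}=\{I\in\mathbb{H}: I^2=-1\}$, and for $I\in\mathbb{S}$, $\mathbb{C}_I=\mathbb{R}+I\mathbb{R}$. A domain is a nonempty connected open subset of $\mathbb{H}\cong\mathbb{R}^4$ (resp. of $\mathbb{C}_I$). A symmetric slice domain is a domain $D\subset\mathbb{H}$ such that $D\cap\mathbb{R}\neq\emptyset$, $D\cap\mathbb{C}_I$ is a domain in $\mathbb{C}_I$ for every $I\in\mathbb{S}$, and whenever $x+Iy\in D$ ($x,y\in\mathbb{R}$, $I\in\mathbb{S}$) then $x+Jy\in D$ for all $J\in\mathbb{S}$. A function $f:D\to\mathbb{H}$ is regular if for every $I\in\mathbb{S}$ its restriction $f_I$ to $D\cap\mathbb{C}_I$ has continuous partial derivatives and satisfies $\frac12\left(\frac{\partial}{\partial x}+I\frac{\partial}{\partial y}\right)f_I(x+Iy)=0$ for all $x+Iy\in D\cap\mathbb{C}_I$. A regular $f$ is slice preserving if $f(D\cap\mathbb{C}_I)\subset\mathbb{C}_I$ for every $I\in\mathbb{S}$. $\mathcal{O}_s(D)$ is the set of slice preserving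 regular functions on $D$; with pointwise operations it is a commutative integral domain. Singularities: let $f$ be regular on a symmetric slice domain $A$. A point $p\in\mathbb{C}_I$ is a singularity of $f$ if $A$ contains $\{z\in\mathbb{C}_I:0<|z-p|<R\}$ for some $R>0$; on this set $f(z)=\sum_{n\in\mathbb{Z}}(z-p)^n a_n$ with unique $a_n\in\mathbb{H}$ (Laurent expansion). The singularity is removable if $f$ extends to a regular function on a neighborhood of $p$; a nonremovable singularity is a pole if there is an integer $\ell\ge0$ with $a_{-n}=0$ for all $n>\ell$. A slice preserving semiregular function on $D$ is a function $f$ which is slice preserving regular on some symmetric slice domain $A\subset D$ and such that every point of $D\setminus A$ is a pole or a removable singularity of $f$. $\mathcal{M}_s(D)$ is the set of these functions (two being identified if they agree where both are regular, removable singularities being filled in), with pointwise addition and multiplication; it is a field containing $\mathcal{O}_s(D)$. *)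

theory Defs
  imports "HOL-Analysis.Analysis" "HOL-Algebra.Ring"
begin

section \<open>Quaternions\<close>

codatatype quat = Quat (qRe: real) (qI: real) (qJ: real) (qK: real)

lemma quat_eq_iff: "x = y \<longleftrightarrow> qRe x = qRe y \<and> qI x = qI y \<and> qJ x = qJ y \<and> qK x = qK y"
  by (auto intro: quat.expand)

instantiation quat :: ab_group_add
begin

primcorec zero_quat where
  "qRe 0 = 0" | "qI 0 = 0" | "qJ 0 = 0" | "qK 0 = 0"

primcorec plus_quat where
  "qRe (x + y) = qRe x + qRe y"
| "qI (x + y) = qI x + qI y"
| "qJ (x + y) = qJ x + qJ y"
| "qK (x + y) = qK x + qK y"

primcorec uminus_quat where
  "qRe (- x) = - qRe x" | "qI (- x) = - qI x" | "qJ (- x) = - qJ x" | "qK (- x) = - qK x"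

primcorec minus_quat where
  "qRe (x - y) = qRe x - qRe y"
| "qI (x - y) = qI x - qI y"
| "qJ (x - y) = qJ x - qJ y"
| "qK (x - y) = qK x - qK y"

instance
  by standard (simp_all add: quat_eq_iff)

end

instantiation quat :: real_algebra_1
begin

primcorec one_quat where
  "qRe 1 = 1" | "qI 1 = 0" | "qJ 1 = 0" | "qK 1 = 0"

primcorec times_quat where
  "qRe (x * y) = qRe x * qRe y - qI x * qI y - qJ x * qJ y - qK x * qK y"
| "qI (x * y) = qRe x * qI y + qI x * qRe y + qJ x * qK y - qK x * qJ y"
| "qJ (x * y) = qRe x * qJ y - qI x * qK y + qJ x * qRe y + qK x * qI y"
| "qK (x * y) = qRe x * qK y + qI x * qJ y - qJ x * qI y + qK x * qRe y"

primcorec scaleR_quat where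
  "qRe (scaleR r x) = r * qRe x"
| "qI (scaleR r x) = r * qI x"
| "qJ (scaleR r x) = r * qJ x"
| "qK (scaleR r x) = r * qK x"

instance
  by standard (simp_all add: quat_eq_iff algebra_simps)

end

instantiation quat :: real_normed_vector
begin

definition norm_quat_def: "norm q = sqrt ((qRe q)\<^sup>2 + (qI q)\<^sup>2 + (qJ q)\<^sup>2 + (qK q)\<^sup>2)"

definition sgn_quat_def: "sgn (q :: quat) = q /\<^sub>R norm q"

definition dist_quat_def: "dist (p :: quat) q = norm (p - q)"

definition uniformity_quat_def [code del]:
  "(uniformity :: (quat \<times> quat) filter) = (INF e\<in>{0 <..}. principal {(x, y). dist x y < e})"

definition open_quat_def [code del]:
  "open (U :: quat set) \<longleftrightarrow> (\<forall>x\<in>U. eventually (\<lambda>(x', y). x' = x \<longrightarrow> y \<in> U) uniformity)"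

instance
proof
  fix r :: real and x y :: quat and U :: "quat set"
  have norm_prod: "norm q = norm ((qRe q, qI q), (qJ q, qK q))" for q :: quat
    by (simp add: norm_quat_def norm_prod_def add.assoc)
  show "norm x = 0 \<longleftrightarrow> x = 0"
    unfolding norm_prod by (simp add: quat_eq_iff zero_prod_def)
  show "norm (x + y) \<le> norm x + norm y"
    unfolding norm_prod 
    using norm_triangle_ineq[of "((qRe x, qI x), (qJ x, qK x))" "((qRe y, qI y), (qJ y, qK y))"] by simp
  show "norm (r *\<^sub>R x) = \<bar>r\<bar> * norm x"
    unfolding norm_prod using norm_scaleR[of r "((qRe x, qI x), (qJ x, qK x))"] by simp
qed (rule sgn_quat_def dist_quat_def uniformity_quat_def open_quat_def)+

end

instantiation quat :: real_normed_div_algebra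
begin

primcorec inverse_quat where
  "qRe (inverse x) = qRe x / ((qRe x)\<^sup>2 + (qI x)\<^sup>2 + (qJ x)\<^sup>2 + (qK x)\<^sup>2)"
| "qI (inverse x) = - qI x / ((qRe x)\<^sup>2 + (qI x)\<^sup>2 + (qJ x)\<^sup>2 + (qK x)\<^sup>2)"
| "qJ (inverse x) = - qJ x / ((qRe x)\<^sup>2 + (qI x)\<^sup>2 + (qJ x)\<^sup>2 + (qK x)\<^sup>2)"
| "qK (inverse x) = - qK x / ((qRe x)\<^sup>2 + (qI x)\<^sup>2 + (qJ x)\<^sup>2 + (qK x)\<^sup>2)"

definition "x div y = x * inverse y" for x y :: quat

instance
proof
  fix x y :: quat
  let ?n = "\<lambda>x. (qRe x)\<^sup>2 + (qI x)\<^sup>2 + (qJ x)\<^sup>2 + (qK x)\<^sup>2"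
  have n: "?n x \<noteq> 0" if "x \<noteq> 0"
    using that norm_eq_zero[of x] by (auto simp: norm_quat_def)
  { assume "x \<noteq> 0"
    note nx = n[OF this]
    have conj: "inverse x = (1 / ?n x) *\<^sub>R Quat (qRe x) (- qI x) (- qJ x) (- qK x)"
      by (simp add: quat_eq_iff)
    have c1: "Quat (qRe x) (- qI x) (- qJ x) (- qK x) * x = ?n x *\<^sub>R 1"
      by (simp add: quat_eq_iff power2_eq_square)
    have c2: "x * Quat (qRe x) (- qI x) (- qJ x) (- qK x) = ?n x *\<^sub>R 1"
      by (simp add: quat_eq_iff power2_eq_square)
    show "inverse x * x = 1"
      unfolding conj mult_scaleR_left c1 using nx by simp
    show "x * inverse x = 1"
      unfolding conj mult_scaleR_right c2 using nx by simp }
  show "x div y = x * inverse y"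
    by (rule divide_quat_def)
  show "inverse (0 :: quat) = 0"
    by (simp add: quat_eq_iff)
  have "?n (x * y) = ?n x * ?n y"
    by (simp add: power2_eq_square algebra_simps)
  then show "norm (x * y) = norm x * norm y"
    by (simp add: norm_quat_def real_sqrt_mult[symmetric])
qed

end

section \<open>Slices and symmetric slice domains\<close>

definition imag_units :: "quat set" where
  "imag_units = {I. I\<^sup>2 = - 1}"

definition slice_point :: "quat \<Rightarrow> real \<Rightarrow> real \<Rightarrow> quat" where
  "slice_point I x y = of_real x + I * of_real y"

definition slice_plane :: "quat \<Rightarrow> quat set" where
  "slice_plane I = {slice_point I x y | x y. True}"

definition symmetric_slice_domain :: "quat set \<Rightarrow> bool" where
  "symmetric_slice_domain D \<longleftrightarrow>
     D \<noteq> {} \<and> open D \<and> connected D \<and>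
     D \<inter> \<real> \<noteq> {} \<and>
     (\<forall>I\<in>imag_units. D \<inter> slice_plane I \<noteq> {} \<and>
        openin (top_of_set (slice_plane I)) (D \<inter> slice_plane I) \<and>
        connected (D \<inter> slice_plane I)) \<and>
     (\<forall>x y. \<forall>I\<in>imag_units. slice_point I x y \<in> D \<longrightarrow>
        (\<forall>J\<in>imag_units. slice_point J x y \<in> D))"

section \<open>Regular functions\<close>

text \<open>
  \<open>fx\<close> and \<open>fy\<close> are the partial derivatives of the restriction of \<open>f\<close> to the slice of \<open>I\<close>.
  The definition is meant for open \<open>D\<close>, where the two-sided derivatives below depend on the
  values of \<open>f\<close> on \<open>D\<close> only.
\<close>

definition regular_on :: "quat set \<Rightarrow> (quat \<Rightarrow> quat) \<Rightarrow> bool" where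
  "regular_on D f \<longleftrightarrow>
     (\<forall>I\<in>imag_units. \<exists>fx fy :: real \<times> real \<Rightarrow> quat.
        let \<Omega> = {(x, y). slice_point I x y \<in> D} in
        continuous_on \<Omega> fx \<and> continuous_on \<Omega> fy \<and>
        (\<forall>(x, y)\<in>\<Omega>.
           ((\<lambda>s. f (slice_point I s y)) has_vector_derivative fx (x, y)) (at x) \<and>
           ((\<lambda>t. f (slice_point I x t)) has_vector_derivative fy (x, y)) (at y) \<and>
           (1 / 2) *\<^sub>R (fx (x, y) + I * fy (x, y)) = 0))"

definition slice_preserving_on :: "quat set \<Rightarrow> (quat \<Rightarrow> quat) \<Rightarrow> bool" where
  "slice_preserving_on D f \<longleftrightarrow> (\<forall>I\<in>imag_units. f ` (D \<inter> slice_plane I) \<subseteq> slice_plane I)"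

text \<open>
  Functions on \<open>D\<close> are represented by total functions that are \<open>undefined\<close> outside \<open>D\<close>; this is no
  restriction for \<open>D = UNIV\<close>.
\<close>

definition Os :: "quat set \<Rightarrow> (quat \<Rightarrow> quat) set" where
  "Os D = {f \<in> extensional D. regular_on D f \<and> slice_preserving_on D f}"

definition Os_ring :: "quat set \<Rightarrow> (quat \<Rightarrow> quat) ring" where
  "Os_ring D =
     \<lparr>carrier = Os D,
      mult = (\<lambda>f g. restrict (\<lambda>z. f z * g z) D),
      one = restrict (\<lambda>_. 1) D,
      zero = restrict (\<lambda>_. 0) D,
      add = (\<lambda>f g. restrict (\<lambda>z. f z + g z) D)\<rparr>"

section \<open>Singularities\<close>

definition punctured_slice_disc :: "quat \<Rightarrow> quat \<Rightarrow> real \<Rightarrow> quat set" where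
  "punctured_slice_disc I p R = {z \<in> slice_plane I. 0 < dist z p \<and> dist z p < R}"

definition slice_singularity :: "quat set \<Rightarrow> quat \<Rightarrow> quat \<Rightarrow> bool" where
  "slice_singularity A I p \<longleftrightarrow>
     I \<in> imag_units \<and> p \<in> slice_plane I \<and> (\<exists>R>0. punctured_slice_disc I p R \<subseteq> A)"

definition removable_singularity :: "quat set \<Rightarrow> (quat \<Rightarrow> quat) \<Rightarrow> quat \<Rightarrow> quat \<Rightarrow> bool" where
  "removable_singularity A f I p \<longleftrightarrow>
     slice_singularity A I p \<and>
     (\<exists>U g. open U \<and> p \<in> U \<and> regular_on U g \<and> (\<forall>z\<in>A \<inter> U. g z = f z))"

text \<open>The coefficients of a Laurent expansion stand on the right of the powers.\<close>

definition laurent_expansion_at ::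
    "(quat \<Rightarrow> quat) \<Rightarrow> quat \<Rightarrow> quat \<Rightarrow> real \<Rightarrow> (int \<Rightarrow> quat) \<Rightarrow> bool" where
  "laurent_expansion_at f I p R a \<longleftrightarrow>
     (\<forall>z\<in>punctured_slice_disc I p R. ((\<lambda>n. (z - p) powi n * a n) has_sum f z) UNIV)"

definition pole_singularity :: "quat set \<Rightarrow> (quat \<Rightarrow> quat) \<Rightarrow> quat \<Rightarrow> quat \<Rightarrow> bool" where
  "pole_singularity A f I p \<longleftrightarrow>
     slice_singularity A I p \<and> \<not> removable_singularity A f I p \<and>
     (\<exists>R>0. \<exists>a. punctured_slice_disc I p R \<subseteq> A \<and> laurent_expansion_at f I p R a \<and>
        (\<exists>l\<ge>0. \<forall>n>l. a (- n) = 0))"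

section \<open>Slice preserving semiregular functions\<close>

text \<open>
  A semiregular function is first represented by a pair of a symmetric slice domain \<open>A\<close> and a
  function that is regular on \<open>A\<close>; the values of the function outside \<open>A\<close> are irrelevant. Two
  such pairs are then identified if the functions agree where both are given.
\<close>

definition semiregular_reps :: "quat set \<Rightarrow> (quat set \<times> (quat \<Rightarrow> quat)) set" where
  "semiregular_reps D =
     {(A, f). symmetric_slice_domain A \<and> A \<subseteq> D \<and> regular_on A f \<and> slice_preserving_on A f \<and>
        (\<forall>p\<in>D - A. \<forall>I\<in>imag_units. p \<in> slice_plane I \<longrightarrow>
           pole_singularity A f I p \<or> removable_singularity A f I p)}"

definition semiregular_rel ::
    "quat set \<Rightarrow> ((quat set \<times> (quat \<Rightarrow> quat)) \<times> (quat set \<times> (quat \<Rightarrow> quat))) set" where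
  "semiregular_rel D =
     {((A, f), (B, g)). (A, f) \<in> semiregular_reps D \<and> (B, g) \<in> semiregular_reps D \<and>
        (\<forall>z\<in>A \<inter> B. f z = g z)}"

definition Ms :: "quat set \<Rightarrow> (quat set \<times> (quat \<Rightarrow> quat)) set set" where
  "Ms D = semiregular_reps D // semiregular_rel D"

definition Ms_class :: "quat set \<Rightarrow> quat set \<Rightarrow> (quat \<Rightarrow> quat) \<Rightarrow> (quat set \<times> (quat \<Rightarrow> quat)) set" where
  "Ms_class D A f = semiregular_rel D `` {(A, f)}"

definition Ms_ring :: "quat set \<Rightarrow> (quat set \<times> (quat \<Rightarrow> quat)) set ring" where
  "Ms_ring D =
     \<lparr>carrier = Ms D,
      mult = (\<lambda>X Y. \<Union>(A, f)\<in>X. \<Union>(B, g)\<in>Y. Ms_class D (A \<inter> B) (\<lambda>z. f z * g z)),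
      one = Ms_class D D (\<lambda>_. 1),
      zero = Ms_class D D (\<lambda>_. 0),
      add = (\<lambda>X Y. \<Union>(A, f)\<in>X. \<Union>(B, g)\<in>Y. Ms_class D (A \<inter> B) (\<lambda>z. f z + g z))\<rparr>"

definition Os_to_Ms :: "quat set \<Rightarrow> (quat \<Rightarrow> quat) \<Rightarrow> (quat set \<times> (quat \<Rightarrow> quat)) set" where
  "Os_to_Ms D f = Ms_class D D f"

section \<open>Quotient fields\<close>

definition quotient_field_via :: "('a, 'm) ring_scheme \<Rightarrow> ('b, 'n) ring_scheme \<Rightarrow> ('a \<Rightarrow> 'b) \<Rightarrow> bool"
  where
  "quotient_field_via R K \<iota> \<longleftrightarrow>
     domain R \<and> field K \<and> \<iota> \<in> ring_hom R K \<and> inj_on \<iota> (carrier R) \<and>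
     (\<forall>h\<in>carrier K. \<exists>f\<in>carrier R. \<exists>g\<in>carrier R - {\<zero>\<^bsub>R\<^esub>}. h = \<iota> f \<otimes>\<^bsub>K\<^esub> inv\<^bsub>K\<^esub> (\<iota> g))"

end

theory Submission
  imports Defs "HOL-Complex_Analysis.Weierstrass_Factorization"
begin

text \<open>
  A slice preserving regular function maps every slice to itself, and on a slice it is an ordinary
  holomorphic function of the complex coordinate. The slices meet in the real axis, so by the
  identity theorem all these holomorphic functions are one and the same function \<open>F\<close>, which
  moreover satisfies \<open>F (cnj z) = cnj (F z)\<close>; functions with this symmetry are called intrinsic.
  Conversely, every intrinsic function induces a slice preserving regular function. Since the
  correspondence respects Laurent expansions, slice preserving semiregular functions on all
  quaternions correspond to intrinsic meromorphic functions on the complex plane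
  (\<open>semiregular_reps_imp_stem\<close> and \<open>stem_imp_semiregular_reps\<close>), and slice preserving regular
  functions correspond to intrinsic entire functions. The ring axioms, the absence of zero divisors
  and the existence of inverses are inherited from complex functions; identifying functions that
  agree on the common domain is harmless because the omitted points are isolated.

  It remains to write an intrinsic meromorphic function as a quotient of intrinsic entire functions
  without common zeros (\<open>intrinsic_quotient\<close>). The Weierstrass factorization theorem provides such
  a quotient \<open>a / b\<close> without the symmetry. Reflecting \<open>a\<close> and \<open>b\<close> in the real axis multiplies both by the
  same entire function \<open>u\<close> without zeros, for which \<open>u * reflect u = 1\<close>. If \<open>s\<close> is a holomorphic
  square root of \<open>u\<close>, then \<open>s * reflect s = 1\<close>, and therefore \<open>a * s\<close> and \<open>b * s\<close> are fixed by the
  reflection (\<open>symmetrizing_factor\<close>).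
\<close>

section \<open>Complex coordinates on the slices\<close>

lemma imag_units_iff:
  "I \<in> imag_units \<longleftrightarrow> qRe I = 0 \<and> (qI I)\<^sup>2 + (qJ I)\<^sup>2 + (qK I)\<^sup>2 = 1"
proof
  assume "I \<in> imag_units"
  then have "I * I = - 1"
    by (simp add: imag_units_def power2_eq_square)
  then have re: "qRe I * qRe I - qI I * qI I - qJ I * qJ I - qK I * qK I = - 1"
    and im: "qRe I * qI I = 0" "qRe I * qJ I = 0" "qRe I * qK I = 0"
    by (auto simp: quat_eq_iff)
  have "qRe I = 0"
  proof (rule ccontr)
    assume "qRe I \<noteq> 0"
    then have "qRe I * qRe I = - 1"
      using re im by simp
    then show False
      using zero_le_square[of "qRe I"] by linarith
  qed
  then show "qRe I = 0 \<and> (qI I)\<^sup>2 + (qJ I)\<^sup>2 + (qK I)\<^sup>2 = 1"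
    using re by (simp add: power2_eq_square)
next
  assume "qRe I = 0 \<and> (qI I)\<^sup>2 + (qJ I)\<^sup>2 + (qK I)\<^sup>2 = 1"
  then show "I \<in> imag_units"
    by (simp add: imag_units_def quat_eq_iff power2_eq_square)
qed

lemma imag_units_square: "I \<in> imag_units \<Longrightarrow> I * I = - 1"
  by (simp add: imag_units_def power2_eq_square)

lemma quat_of_real_sel [simp]: "qRe (of_real r) = r" "qI (of_real r) = 0" "qJ (of_real r) = 0"
    "qK (of_real r) = 0"
  by (simp_all add: of_real_def)

text \<open>The isometric algebra embedding of the complex numbers onto the slice plane of \<open>I\<close>.\<close>

definition slice_embed :: "quat \<Rightarrow> complex \<Rightarrow> quat" where
  "slice_embed I z = slice_point I (Re z) (Im z)"

lemma slice_embed_sel [simp]: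
  "qRe (slice_embed I z) = Re z + qRe I * Im z"
  "qI (slice_embed I z) = qI I * Im z"
  "qJ (slice_embed I z) = qJ I * Im z"
  "qK (slice_embed I z) = qK I * Im z"
  by (simp_all add: slice_embed_def slice_point_def)

lemma slice_point_eq_embed: "slice_point I x y = slice_embed I (Complex x y)"
  by (simp add: slice_embed_def)

lemma slice_plane_eq: "slice_plane I = range (slice_embed I)"
proof -
  have "slice_point I x y \<in> range (slice_embed I)" for x y
    by (simp add: slice_point_eq_embed)
  then show ?thesis
    by (auto simp: slice_plane_def slice_embed_def)
qed

text \<open>The orthogonal projection onto the plane of \<open>I\<close>, read in its complex coordinate. It is a left
  inverse of \<^const>\<open>slice_embed\<close> that is defined on all quaternions, so that it can be applied to
  functions before they are known to preserve slices.\<close>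

definition slice_coord :: "quat \<Rightarrow> quat \<Rightarrow> complex" where
  "slice_coord I q = Complex (qRe q) (qI I * qI q + qJ I * qJ q + qK I * qK q)"

lemma slice_coord_sel [simp]:
  "Re (slice_coord I q) = qRe q"
  "Im (slice_coord I q) = qI I * qI q + qJ I * qJ q + qK I * qK q"
  by (simp_all add: slice_coord_def)

lemma slice_coord_embed [simp]:
  assumes "I \<in> imag_units" shows "slice_coord I (slice_embed I z) = z"
proof -
  have "qI I * (qI I * Im z) + qJ I * (qJ I * Im z) + qK I * (qK I * Im z)
      = ((qI I)\<^sup>2 + (qJ I)\<^sup>2 + (qK I)\<^sup>2) * Im z"
    by (simp add: power2_eq_square algebra_simps)
  then show ?thesis
    using assms by (auto simp: imag_units_iff complex_eq_iff)
qed

lemma slice_embed_coord: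
  "I \<in> imag_units \<Longrightarrow> q \<in> slice_plane I \<Longrightarrow> slice_embed I (slice_coord I q) = q"
  by (auto simp: slice_plane_eq)

lemma slice_embed_inject [simp]:
  "I \<in> imag_units \<Longrightarrow> slice_embed I z = slice_embed I w \<longleftrightarrow> z = w"
  by (metis slice_coord_embed)

lemma slice_embed_add: "slice_embed I (z + w) = slice_embed I z + slice_embed I w"
  by (simp add: quat_eq_iff algebra_simps)

lemma slice_embed_diff: "slice_embed I (z - w) = slice_embed I z - slice_embed I w"
  by (simp add: quat_eq_iff algebra_simps)

lemma slice_embed_uminus: "slice_embed I (- z) = - slice_embed I z"
  by (simp add: quat_eq_iff algebra_simps)

lemma slice_embed_0 [simp]: "slice_embed I 0 = 0"
  by (simp add: quat_eq_iff)

lemma slice_embed_1 [simp]: "slice_embed I 1 = 1"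
  by (simp add: quat_eq_iff)

lemma slice_embed_eq_0_iff [simp]: "I \<in> imag_units \<Longrightarrow> slice_embed I z = 0 \<longleftrightarrow> z = 0"
  using slice_embed_inject[of I z 0] by simp

lemma slice_embed_mult:
  assumes "I \<in> imag_units"
  shows "slice_embed I (z * w) = slice_embed I z * slice_embed I w"
proof -
  have r: "qRe I = 0" and n: "qI I * qI I + qJ I * qJ I + qK I * qK I = 1"
    using assms by (auto simp: imag_units_iff power2_eq_square)
  have "Im z * Im w = (qI I * qI I + qJ I * qJ I + qK I * qK I) * (Im z * Im w)"
    using n by simp
  then show ?thesis
    using r by (simp add: quat_eq_iff algebra_simps)
qed

lemma slice_embed_inverse:
  assumes "I \<in> imag_units"
  shows "slice_embed I (inverse z) = inverse (slice_embed I z)"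
proof (cases "z = 0")
  case False
  then have "slice_embed I (inverse z) * slice_embed I z = 1"
    by (simp flip: slice_embed_mult[OF assms])
  then show ?thesis
    by (metis inverse_unique inverse_inverse_eq inverse_zero mult_zero_right zero_neq_one)
qed simp

lemma slice_embed_power:
  assumes "I \<in> imag_units"
  shows "slice_embed I (z ^ n) = slice_embed I z ^ n"
  by (induction n) (simp_all add: slice_embed_mult[OF assms])

lemma slice_embed_power_int:
  assumes "I \<in> imag_units"
  shows "slice_embed I (z powi n) = slice_embed I z powi n"
  by (simp add: power_int_def slice_embed_power slice_embed_inverse assms)

text \<open>Left multiplication by \<open>I\<close> preserves both the plane of \<open>I\<close> and its orthogonal complement, so it
  commutes with the projection. This turns the regularity equation on a slice into the
  Cauchy-Riemann equation.\<close>

lemma slice_coord_unit_mult: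
  assumes "I \<in> imag_units"
  shows "slice_coord I (I * q) = \<i> * slice_coord I q"
proof -
  have r: "qRe I = 0" and n: "qI I * qI I + qJ I * qJ I + qK I * qK I = 1"
    using assms by (auto simp: imag_units_iff power2_eq_square)
  have "(qI I * qI I + qJ I * qJ I + qK I * qK I) * qRe q = qRe q"
    using n by simp
  then show ?thesis
    using r by (simp add: complex_eq_iff algebra_simps)
qed

lemma norm_slice_embed [simp]:
  assumes "I \<in> imag_units"
  shows "norm (slice_embed I z) = norm z"
proof -
  have r: "qRe I = 0" and n: "(qI I)\<^sup>2 + (qJ I)\<^sup>2 + (qK I)\<^sup>2 = 1"
    using assms by (auto simp: imag_units_iff)
  have "(qI I * Im z)\<^sup>2 + (qJ I * Im z)\<^sup>2 + (qK I * Im z)\<^sup>2 =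
      ((qI I)\<^sup>2 + (qJ I)\<^sup>2 + (qK I)\<^sup>2) * (Im z)\<^sup>2"
    by (simp add: power_mult_distrib algebra_simps)
  then show ?thesis
    using r n by (simp add: norm_quat_def norm_complex_def add.assoc)
qed

lemma dist_slice_embed [simp]:
  "I \<in> imag_units \<Longrightarrow> dist (slice_embed I z) (slice_embed I w) = dist z w"
  by (simp add: dist_norm flip: slice_embed_diff)

lemma bounded_linear_slice_embed:
  assumes "I \<in> imag_units" shows "bounded_linear (slice_embed I)"
proof (rule bounded_linear_intro[where K = 1])
  show "slice_embed I (r *\<^sub>R x) = r *\<^sub>R slice_embed I x" for r x
    by (simp add: quat_eq_iff algebra_simps)
qed (simp_all add: slice_embed_add assms)

lemma abs_component_le_norm:
  fixes q :: quat
  shows "\<bar>qRe q\<bar> \<le> norm q" "\<bar>qI q\<bar> \<le> norm q" "\<bar>qJ q\<bar> \<le> norm q" "\<bar>qK q\<bar> \<le> norm q"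
  unfolding norm_quat_def by (rule real_le_rsqrt; simp)+

lemma bounded_linear_qRe: "bounded_linear qRe" and bounded_linear_qI: "bounded_linear qI"
  and bounded_linear_qJ: "bounded_linear qJ" and bounded_linear_qK: "bounded_linear qK"
  by (rule bounded_linear_intro[where K = 1]; simp add: abs_component_le_norm)+

lemmas continuous_on_quat_component [continuous_intros] =
  bounded_linear.continuous_on[OF bounded_linear_qRe]
  bounded_linear.continuous_on[OF bounded_linear_qI]
  bounded_linear.continuous_on[OF bounded_linear_qJ]
  bounded_linear.continuous_on[OF bounded_linear_qK]

lemma bounded_linear_slice_coord: "bounded_linear (slice_coord I)"
proof -
  have "bounded_linear (\<lambda>q. of_real (qRe q) + \<i> * of_real (qI q * qI I + qJ q * qJ I + qK q * qK I))"
    by (intro bounded_linear_add bounded_linear_const_mult bounded_linear_mult_const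
        bounded_linear_compose[OF bounded_linear_of_real]
        bounded_linear_qRe bounded_linear_qI bounded_linear_qJ bounded_linear_qK)
  moreover have "slice_coord I =
      (\<lambda>q. of_real (qRe q) + \<i> * of_real (qI q * qI I + qJ q * qJ I + qK q * qK I))"
    by (auto simp: complex_eq_iff)
  ultimately show ?thesis
    by simp
qed

lemma continuous_on_slice_embed: "I \<in> imag_units \<Longrightarrow> continuous_on S (slice_embed I)"
  using bounded_linear_slice_embed linear_continuous_on by blast

lemma open_vimage_slice_embed:
  "I \<in> imag_units \<Longrightarrow> open A \<Longrightarrow> open (slice_embed I -` A)"
  using continuous_on_slice_embed[of I UNIV] by (simp add: continuous_on_open_vimage)

lemma imag_units_uminus: "I \<in> imag_units \<Longrightarrow> - I \<in> imag_units"
  by (simp add: imag_units_def)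

lemma slice_embed_cnj: "slice_embed I (cnj z) = slice_embed (- I) z"
  by (simp add: quat_eq_iff slice_embed_def slice_point_def)

text \<open>Every quaternion is \<open>slice_embed (axis_unit q) (half_coord q)\<close> with a coordinate in the closed
  upper half plane. A real point lies on all slices; \<open>std_unit\<close> is the arbitrary choice there.\<close>

definition std_unit :: quat where
  "std_unit = Quat 0 1 0 0"

lemma std_unit_in_imag_units [simp]: "std_unit \<in> imag_units"
  by (simp add: std_unit_def imag_units_iff)

definition half_coord :: "quat \<Rightarrow> complex" where
  "half_coord q = Complex (qRe q) (sqrt ((qI q)\<^sup>2 + (qJ q)\<^sup>2 + (qK q)\<^sup>2))"

definition axis_unit :: "quat \<Rightarrow> quat" where
  "axis_unit q = (if Im (half_coord q) = 0 then std_unit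
     else Quat 0 (qI q / Im (half_coord q)) (qJ q / Im (half_coord q)) (qK q / Im (half_coord q)))"

lemma half_coord_sel [simp]:
  "Re (half_coord q) = qRe q"
  "Im (half_coord q) = sqrt ((qI q)\<^sup>2 + (qJ q)\<^sup>2 + (qK q)\<^sup>2)"
  by (simp_all add: half_coord_def)

lemma axis_unit_in_imag_units [simp]: "axis_unit q \<in> imag_units"
proof (cases "Im (half_coord q) = 0")
  case False
  define s where "s = (qI q)\<^sup>2 + (qJ q)\<^sup>2 + (qK q)\<^sup>2"
  have s: "s \<noteq> 0" "s \<ge> 0"
    using False by (auto simp: s_def)
  have "(qI q)\<^sup>2 / s + (qJ q)\<^sup>2 / s + (qK q)\<^sup>2 / s = 1"
    using s by (simp add: s_def flip: add_divide_distrib)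
  then show ?thesis
    using False s unfolding imag_units_iff axis_unit_def half_coord_sel s_def[symmetric]
    by (simp add: power_divide)
qed (simp add: axis_unit_def)

lemma slice_embed_axis_half [simp]: "slice_embed (axis_unit q) (half_coord q) = q"
proof (cases "Im (half_coord q) = 0")
  case True
  then have "(qI q)\<^sup>2 + ((qJ q)\<^sup>2 + (qK q)\<^sup>2) = 0"
    by (simp add: add.assoc)
  then have "qI q = 0 \<and> qJ q = 0 \<and> qK q = 0"
    by (smt (verit) power2_eq_square mult_eq_0_iff zero_le_power2 power_eq_0_iff)
  then show ?thesis
    by (simp add: axis_unit_def quat_eq_iff std_unit_def)
next
  case False
  then have "qRe (axis_unit q) = 0" "qI (axis_unit q) * Im (half_coord q) = qI q"
     "qJ (axis_unit q) * Im (half_coord q) = qJ q" "qK (axis_unit q) * Im (half_coord q) = qK q"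
    by (simp_all add: axis_unit_def del: half_coord_sel)
  then show ?thesis
    by (simp add: quat_eq_iff del: half_coord_sel(2))
qed

lemma half_coord_embed:
  assumes "I \<in> imag_units"
  shows "half_coord (slice_embed I z) = (if Im z \<ge> 0 then z else cnj z)"
proof -
  have r: "qRe I = 0" and n: "(qI I)\<^sup>2 + (qJ I)\<^sup>2 + (qK I)\<^sup>2 = 1"
    using assms by (auto simp: imag_units_iff)
  have "(qI I * Im z)\<^sup>2 + (qJ I * Im z)\<^sup>2 + (qK I * Im z)\<^sup>2 =
      ((qI I)\<^sup>2 + (qJ I)\<^sup>2 + (qK I)\<^sup>2) * (Im z)\<^sup>2"
    by (simp add: power_mult_distrib algebra_simps)
  then show ?thesis
    using r n by (simp add: complex_eq_iff)
qed

lemma quat_cases_slice: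
  obtains I z where "I \<in> imag_units" "q = slice_embed I z"
  by (metis axis_unit_in_imag_units slice_embed_axis_half)

lemma continuous_on_half_coord: "continuous_on S half_coord"
proof -
  have eq: "half_coord = (\<lambda>q. of_real (qRe q) + \<i> * of_real (sqrt ((qI q)\<^sup>2 + (qJ q)\<^sup>2 + (qK q)\<^sup>2)))"
    by (auto simp: complex_eq_iff)
  show ?thesis
    unfolding eq by (intro continuous_intros)
qed

section \<open>Regular functions and holomorphic functions\<close>

text \<open>Existence of the horizontal and continuity of the vertical partial derivative give real
  differentiability; the Cauchy-Riemann equation makes the differential complex linear.\<close>

lemma holomorphic_on_continuous_partials:
  fixes h :: "complex \<Rightarrow> complex" and hx hy :: "real \<times> real \<Rightarrow> complex"
  assumes S: "open S"
    and cont: "continuous_on {(x, y). Complex x y \<in> S} hy"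
    and hx: "\<And>x y. Complex x y \<in> S \<Longrightarrow>
      ((\<lambda>s. h (Complex s y)) has_vector_derivative hx (x, y)) (at x)"
    and hy: "\<And>x y. Complex x y \<in> S \<Longrightarrow>
      ((\<lambda>t. h (Complex x t)) has_vector_derivative hy (x, y)) (at y)"
    and CR: "\<And>x y. Complex x y \<in> S \<Longrightarrow> hy (x, y) = \<i> * hx (x, y)"
  shows "h holomorphic_on S"
proof -
  define \<Omega> where "\<Omega> = {(x, y). Complex x y \<in> S}"
  have \<Omega>_eq: "\<Omega> = (\<lambda>p. of_real (fst p) + \<i> * of_real (snd p)) -` S"
    by (auto simp: \<Omega>_def Complex_eq)
  have "open \<Omega>"
    unfolding \<Omega>_eq by (intro open_vimage S continuous_intros)
  have "\<exists>D. (h has_field_derivative D) (at z)" if "z \<in> S" for z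
  proof -
    define x y where "x = Re z" and "y = Im z"
    have z: "z = Complex x y"
      by (simp add: x_def y_def)
    then have "(x, y) \<in> \<Omega>"
      using that by (simp add: \<Omega>_def)
    then obtain X Y' where XY': "open X" "open Y'" "x \<in> X" "y \<in> Y'" "X \<times> Y' \<subseteq> \<Omega>"
      using \<open>open \<Omega>\<close> by (elim open_prod_elim) auto
    then obtain e where "e > 0" "ball y e \<subseteq> Y'"
      by (meson open_contains_ball)
    define Y where "Y = ball y e"
    have Y: "open Y" "convex Y" "y \<in> Y" "X \<times> Y \<subseteq> \<Omega>"
      using XY' \<open>e > 0\<close> \<open>ball y e \<subseteq> Y'\<close> by (auto simp: Y_def)
    have "((\<lambda>(x, y). h (Complex x y)) has_derivative
        (\<lambda>(tx, ty). tx *\<^sub>R hx (x, y) + blinfun_scaleR_left (hy (x, y)) ty)) (at (x, y) within X \<times> Y)"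
    proof (rule has_derivative_partialsI)
      show "((\<lambda>s. h (Complex s y)) has_derivative (\<lambda>t. t *\<^sub>R hx (x, y))) (at x within X)"
        using hx[of x y] that z has_derivative_at_withinI
        unfolding has_vector_derivative_def by blast
      show "((\<lambda>t. h (Complex a t)) has_derivative blinfun_scaleR_left (hy (a, b))) (at b within Y)"
        if "a \<in> X" "b \<in> Y" for a b
      proof -
        have "Complex a b \<in> S"
          using that Y(4) by (auto simp: \<Omega>_def)
        then show ?thesis
          using hy[of a b] has_derivative_at_withinI
          unfolding has_vector_derivative_def by auto
      qed
      have "isCont hy (x, y)"
        using cont \<open>open \<Omega>\<close> \<open>(x, y) \<in> \<Omega>\<close> by (simp add: continuous_on_eq_continuous_at \<Omega>_def)
      then have "isCont (\<lambda>p. blinfun_scaleR_left (hy p)) (x, y)"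
        by (intro bounded_linear.isCont[OF bounded_linear_blinfun_scaleR_left])
      then show "continuous (at (x, y) within X \<times> Y) (\<lambda>(a, b). blinfun_scaleR_left (hy (a, b)))"
        by (simp add: case_prod_unfold continuous_at_imp_continuous_at_within)
    qed (use Y in auto)
    then have "((\<lambda>(x, y). h (Complex x y)) has_derivative
        (\<lambda>(tx, ty). tx *\<^sub>R hx (x, y) + ty *\<^sub>R hy (x, y))) (at (x, y))"
      using XY' Y by (simp add: at_within_open[OF _ open_Times])
    moreover have "((\<lambda>z. (Re z, Im z)) has_derivative (\<lambda>t. (Re t, Im t))) (at z)"
      by (intro has_derivative_Pair bounded_linear_imp_has_derivative
          bounded_linear_Re bounded_linear_Im)
    ultimately have "((\<lambda>w. h (Complex (Re w) (Im w))) has_derivative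
        (\<lambda>t. Re t *\<^sub>R hx (x, y) + Im t *\<^sub>R hy (x, y))) (at z)"
      using has_derivative_compose[of "\<lambda>z. (Re z, Im z)" "\<lambda>t. (Re t, Im t)" z UNIV
          "\<lambda>(x, y). h (Complex x y)" "\<lambda>(tx, ty). tx *\<^sub>R hx (x, y) + ty *\<^sub>R hy (x, y)"]
      by (simp add: z)
    moreover have "(\<lambda>t. Re t *\<^sub>R hx (x, y) + Im t *\<^sub>R hy (x, y)) = (*) (hx (x, y))"
    proof
      fix t :: complex
      have "hx (x, y) * t = hx (x, y) * (of_real (Re t) + \<i> * of_real (Im t))"
        by (simp flip: complex_eq)
      then show "Re t *\<^sub>R hx (x, y) + Im t *\<^sub>R hy (x, y) = hx (x, y) * t"
        using CR[of x y] that z by (simp add: scaleR_conv_of_real algebra_simps)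
    qed
    ultimately show ?thesis
      by (auto simp: has_field_derivative_def)
  qed
  then show ?thesis
    by (simp add: holomorphic_on_open S)
qed

text \<open>The projection of a regular function to a slice satisfies the Cauchy-Riemann equation there,
  even if the function does not map the slice to itself. The extension that witnesses a removable
  singularity is only known to be regular, so this generality matters later.\<close>

lemma regular_on_imp_holomorphic_slice_coord:
  assumes U: "open U" and g: "regular_on U g" and I: "I \<in> imag_units"
  shows "(\<lambda>z. slice_coord I (g (slice_embed I z))) holomorphic_on (slice_embed I -` U)"
proof -
  obtain gx gy where cont: "continuous_on {(x, y). slice_embed I (Complex x y) \<in> U} gy"
    and gx: "\<And>x y. slice_embed I (Complex x y) \<in> U \<Longrightarrow>
      ((\<lambda>s. g (slice_embed I (Complex s y))) has_vector_derivative gx (x, y)) (at x)"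
    and gy: "\<And>x y. slice_embed I (Complex x y) \<in> U \<Longrightarrow>
      ((\<lambda>t. g (slice_embed I (Complex x t))) has_vector_derivative gy (x, y)) (at y)"
    and CR: "\<And>x y. slice_embed I (Complex x y) \<in> U \<Longrightarrow> gx (x, y) + I * gy (x, y) = 0"
  proof -
    obtain gx gy where *: "continuous_on {(x, y). slice_embed I (Complex x y) \<in> U} gy \<and>
        (\<forall>(x, y)\<in>{(x, y). slice_embed I (Complex x y) \<in> U}.
          ((\<lambda>s. g (slice_embed I (Complex s y))) has_vector_derivative gx (x, y)) (at x) \<and>
          ((\<lambda>t. g (slice_embed I (Complex x t))) has_vector_derivative gy (x, y)) (at y) \<and>
          (1 / 2) *\<^sub>R (gx (x, y) + I * gy (x, y)) = 0)"
      using bspec[OF g[unfolded regular_on_def slice_point_eq_embed Let_def] I] by blast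
    show thesis
      by (rule that[of gy gx]) (use * in auto)
  qed
  show ?thesis
  proof (rule holomorphic_on_continuous_partials)
    show "open (slice_embed I -` U)"
      by (rule open_vimage_slice_embed[OF I U])
    show "continuous_on {(x, y). Complex x y \<in> slice_embed I -` U} (\<lambda>p. slice_coord I (gy p))"
      by (intro bounded_linear.continuous_on[OF bounded_linear_slice_coord]) (use cont in simp)
    show "((\<lambda>s. slice_coord I (g (slice_embed I (Complex s y)))) has_vector_derivative
        slice_coord I (gx (x, y))) (at x)" if "Complex x y \<in> slice_embed I -` U" for x y
      using gx[of x y] that
      by (intro bounded_linear.has_vector_derivative[OF bounded_linear_slice_coord]) auto
    show "((\<lambda>t. slice_coord I (g (slice_embed I (Complex x t)))) has_vector_derivative
        slice_coord I (gy (x, y))) (at y)" if "Complex x y \<in> slice_embed I -` U" for x y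
      using gy[of x y] that
      by (intro bounded_linear.has_vector_derivative[OF bounded_linear_slice_coord]) auto
    show "slice_coord I (gy (x, y)) = \<i> * slice_coord I (gx (x, y))"
      if "Complex x y \<in> slice_embed I -` U" for x y
    proof -
      have "gx (x, y) = - (I * gy (x, y))"
        using CR[of x y] that by (simp add: eq_neg_iff_add_eq_0)
      then have "I * gx (x, y) = gy (x, y)"
        using imag_units_square[OF I] by (simp flip: mult.assoc)
      then show ?thesis
        using slice_coord_unit_mult[OF I] by metis
    qed
  qed
qed

lemma regular_on_if_holomorphic:
  assumes U: "open U"
    and F: "\<And>I. I \<in> imag_units \<Longrightarrow> F holomorphic_on (slice_embed I -` U)"
    and f: "\<And>I z. I \<in> imag_units \<Longrightarrow> slice_embed I z \<in> U \<Longrightarrow> f (slice_embed I z) = slice_embed I (F z)"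
  shows "regular_on U f"
  unfolding regular_on_def Let_def
proof
  fix I assume I: "I \<in> imag_units"
  define \<Omega> where "\<Omega> = slice_embed I -` U"
  have \<Omega>: "open \<Omega>"
    unfolding \<Omega>_def by (rule open_vimage_slice_embed[OF I U])
  have hol: "F holomorphic_on \<Omega>"
    using F[OF I] by (simp add: \<Omega>_def)
  let ?e = "\<lambda>p. Complex (fst p) (snd p)"
  let ?P = "{(x, y). slice_point I x y \<in> U}"
  define fx where "fx = (\<lambda>p. slice_embed I (deriv F (?e p)))"
  define fy where "fy = (\<lambda>p. slice_embed I (\<i> * deriv F (?e p)))"
  have cont: "continuous_on ?P (\<lambda>p. deriv F (?e p))"
  proof (rule continuous_on_compose2[of \<Omega> "deriv F"])
    show "continuous_on \<Omega> (deriv F)"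
      using hol \<Omega> holomorphic_deriv holomorphic_on_imp_continuous_on by blast
    show "continuous_on ?P ?e"
      unfolding Complex_eq by (intro continuous_intros)
  qed (auto simp: \<Omega>_def slice_point_eq_embed)
  have "continuous_on ?P fx" "continuous_on ?P fy"
    unfolding fx_def fy_def
    by (intro bounded_linear.continuous_on[OF bounded_linear_slice_embed[OF I]] continuous_intros cont)+
  moreover have "((\<lambda>s. f (slice_point I s y)) has_vector_derivative fx (x, y)) (at x)"
      "((\<lambda>t. f (slice_point I x t)) has_vector_derivative fy (x, y)) (at y)"
      "(1 / 2) *\<^sub>R (fx (x, y) + I * fy (x, y)) = 0"
    if "slice_point I x y \<in> U" for x y
  proof -
    have mem: "Complex x y \<in> \<Omega>"
      using that by (simp add: \<Omega>_def slice_point_eq_embed)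
    have D: "(F has_field_derivative deriv F (Complex x y)) (at (Complex x y))"
      by (rule holomorphic_derivI[OF hol \<Omega> mem])
    have vx: "((\<lambda>s. Complex s y) has_vector_derivative 1) (at x)"
      unfolding Complex_eq by (auto intro!: derivative_eq_intros)
    have vy: "((\<lambda>t. Complex x t) has_vector_derivative \<i>) (at y)"
      unfolding Complex_eq by (auto intro!: derivative_eq_intros)
    have "((\<lambda>s. slice_embed I (F (Complex s y))) has_vector_derivative fx (x, y)) (at x)"
      using field_vector_diff_chain_at[OF vx D]
        bounded_linear.has_vector_derivative[OF bounded_linear_slice_embed[OF I]]
      by (fastforce simp: fx_def o_def)
    moreover have "open ((\<lambda>s. Complex s y) -` \<Omega>)"
      unfolding Complex_eq by (intro open_vimage \<Omega> continuous_intros)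
    ultimately show "((\<lambda>s. f (slice_point I s y)) has_vector_derivative fx (x, y)) (at x)"
      by (rule has_vector_derivative_transform_within_open)
        (use mem f[OF I] in \<open>auto simp: \<Omega>_def slice_point_eq_embed\<close>)
    have "((\<lambda>t. slice_embed I (F (Complex x t))) has_vector_derivative fy (x, y)) (at y)"
      using field_vector_diff_chain_at[OF vy D]
        bounded_linear.has_vector_derivative[OF bounded_linear_slice_embed[OF I]]
      by (fastforce simp: fy_def o_def)
    moreover have "open ((\<lambda>t. Complex x t) -` \<Omega>)"
      unfolding Complex_eq by (intro open_vimage \<Omega> continuous_intros)
    ultimately show "((\<lambda>t. f (slice_point I x t)) has_vector_derivative fy (x, y)) (at y)"
      by (rule has_vector_derivative_transform_within_open)
        (use mem f[OF I] in \<open>auto simp: \<Omega>_def slice_point_eq_embed\<close>)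
    have "I = slice_embed I \<i>"
      using I by (simp add: quat_eq_iff imag_units_iff)
    then have "I * fy (x, y) = slice_embed I (\<i> * (\<i> * deriv F (Complex x y)))"
      by (metis fst_conv fy_def slice_embed_mult[OF I] snd_conv)
    also have "\<dots> = - fx (x, y)"
      by (simp add: fx_def slice_embed_uminus flip: mult.assoc)
    finally show "(1 / 2) *\<^sub>R (fx (x, y) + I * fy (x, y)) = 0"
      by simp
  qed
  ultimately show "\<exists>fx fy. continuous_on ?P fx \<and> continuous_on ?P fy \<and>
      (\<forall>(x, y)\<in>?P.
         ((\<lambda>s. f (slice_point I s y)) has_vector_derivative fx (x, y)) (at x) \<and>
         ((\<lambda>t. f (slice_point I x t)) has_vector_derivative fy (x, y)) (at y) \<and>
         (1 / 2) *\<^sub>R (fx (x, y) + I * fy (x, y)) = 0)"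
    by blast
qed

section \<open>Laurent expansions and poles\<close>

lemma has_sum_int_shift_iff:
  fixes f :: "int \<Rightarrow> 'a :: {comm_monoid_add, topological_space}"
  assumes "\<And>n. n < m \<Longrightarrow> f n = 0"
  shows "(f has_sum s) UNIV \<longleftrightarrow> ((\<lambda>k. f (int k + m)) has_sum s) UNIV"
proof -
  have "n < m" if "n \<notin> range (\<lambda>k. int k + m)" for n
    using that rangeI[of "\<lambda>k. int k + m" "nat (n - m)"] by (cases "m \<le> n") auto
  then have "(f has_sum s) UNIV \<longleftrightarrow> (f has_sum s) (range (\<lambda>k. int k + m))"
    using assms by (intro has_sum_cong_neutral) auto
  also have "\<dots> \<longleftrightarrow> ((f \<circ> (\<lambda>k. int k + m)) has_sum s) UNIV"
    by (rule has_sum_reindex) (auto simp: inj_on_def)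
  finally show ?thesis
    by (simp add: o_def)
qed

text \<open>A quaternionic Laurent expansion is an unordered sum over the integers. Convergence of the partial
  sums at a point farther from \<open>z0\<close> makes the complex series absolutely convergent at \<open>z\<close>, and so
  summable in every order.\<close>

lemma meromorphic_imp_laurent_series:
  assumes "F meromorphic_on {z0}"
  shows "\<exists>c l R. l \<ge> 0 \<and> (\<forall>n>l. c (- n) = 0) \<and> R > 0 \<and>
    (\<forall>z. 0 < dist z z0 \<and> dist z z0 < R \<longrightarrow>
       ((\<lambda>n. (z - z0) powi n * c n) has_sum F z) UNIV)"
proof -
  obtain L where L: "(\<lambda>w. F (z0 + w)) has_laurent_expansion L"
    using assms by (auto simp: meromorphic_on_def)
  obtain e where e: "e > 0" "\<And>w. w \<noteq> 0 \<Longrightarrow> norm w < e \<Longrightarrow> eval_fls L w = F (z0 + w)"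
    using L by (auto simp: has_laurent_expansion_def eventually_at)
  obtain r where r: "r > 0" "ereal r < fls_conv_radius L"
    using L unfolding has_laurent_expansion_def
    by (metis ereal_dense2 ereal_less(2) )
  define m where "m = fls_subdegree L"
  define R where "R = min e r"
  have sums: "(\<lambda>k. fls_nth L (int k + m) * w powi (int k + m)) sums eval_fls L w"
    if "w \<noteq> 0" "norm w \<le> r" for w
    unfolding m_def using that r by (intro sums_eval_fls) (auto intro: le_less_trans[of _ "ereal r"])
  have "((\<lambda>n. (z - z0) powi n * fls_nth L n) has_sum F z) UNIV"
    if z: "0 < dist z z0" "dist z z0 < R" for z
  proof -
    define w where "w = z - z0"
    have w: "w \<noteq> 0" "norm w < e" "norm w < r"
      using z by (auto simp: w_def R_def dist_norm)
    define x where "x = complex_of_real r"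
    have x: "x \<noteq> 0" "norm x = r"
      using r by (auto simp: x_def)
    have powi: "v powi (int k + m) = v ^ k * v powi m" if "v \<noteq> 0" for v :: complex and k
      using that by (simp add: power_int_add)
    have "summable (\<lambda>k. fls_nth L (int k + m) * x ^ k * x powi m)"
      using sums_summable[OF sums[of x]] x by (simp add: powi mult_ac)
    then have "summable (\<lambda>k. fls_nth L (int k + m) * x ^ k)"
      using summable_mult2[of "\<lambda>k. fls_nth L (int k + m) * x ^ k * x powi m" "inverse (x powi m)"] x
      by (simp add: mult.assoc)
    then have "summable (\<lambda>k. norm (fls_nth L (int k + m) * w ^ k))"
      by (rule powser_insidea) (use w x in simp)
    then have "summable (\<lambda>k. norm (fls_nth L (int k + m) * w ^ k) * norm (w powi m))"
      by (rule summable_mult2)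
    then have "summable (\<lambda>k. norm (fls_nth L (int k + m) * w powi (int k + m)))"
      using w by (simp add: powi norm_mult mult_ac)
    moreover have "(\<lambda>k. fls_nth L (int k + m) * w powi (int k + m)) sums F z"
      using sums[of w] e(2)[of w] w by (simp add: w_def)
    ultimately have "((\<lambda>k. fls_nth L (int k + m) * w powi (int k + m)) has_sum F z) UNIV"
      by (rule norm_summable_imp_has_sum)
    then show ?thesis
      by (subst has_sum_int_shift_iff[of m]) (auto simp: m_def w_def mult_ac)
  qed
  moreover have "R > 0"
    using e r by (simp add: R_def)
  moreover have "\<forall>n > max 0 (- m). fls_nth L (- n) = 0"
    by (auto simp: m_def)
  ultimately show ?thesis
    by (intro exI[of _ "fls_nth L"] exI[of _ "max 0 (- m)"] exI[of _ R]) auto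
qed

text \<open>A Laurent series that converges at a single point \<open>w\<close> has bounded terms there. If its principal
  part is finite, then the series, multiplied by \<open>v powi l\<close>, is dominated by a geometric series with
  ratio \<open>1 / 2\<close> for \<open>norm v \<le> norm w / 2\<close>. Only the norm is used, so the coefficients may lie in a
  noncommutative division algebra.\<close>

lemma finite_principal_part_bounded:
  fixes a :: "int \<Rightarrow> 'a :: real_normed_div_algebra"
  assumes w: "w \<noteq> 0" and s: "((\<lambda>n. w powi n * a n) has_sum s) UNIV"
    and a: "\<And>n. n > l \<Longrightarrow> a (- n) = 0"
  shows "\<exists>M. \<forall>v t. v \<noteq> 0 \<longrightarrow> norm v \<le> norm w / 2 \<longrightarrow> ((\<lambda>n. v powi n * a n) has_sum t) UNIV \<longrightarrow>
    norm t * norm v powi l \<le> M"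
proof -
  define b where "b = (\<lambda>k. a (int k - l))"
  have sums: "(\<lambda>k. v powi (int k - l) * b k) sums t"
    if "((\<lambda>n. v powi n * a n) has_sum t) UNIV" for v t
  proof -
    have z: "a n = 0" if "n < - l" for n
      using a[of "- n"] that by simp
    have "((\<lambda>k. v powi (int k + - l) * a (int k + - l)) has_sum t) UNIV"
      using that z has_sum_int_shift_iff[of "- l" "\<lambda>n. v powi n * a n" t] by simp
    then show ?thesis
      by (intro has_sum_imp_sums) (simp add: b_def)
  qed
  have "(\<lambda>k. w powi (int k - l) * b k) \<longlonglongrightarrow> 0"
    using sums[OF s] sums_summable summable_LIMSEQ_zero by blast
  then have "Bseq (\<lambda>k. w powi (int k - l) * b k)"
    using convergent_def convergent_imp_Bseq by blast
  then obtain M where M: "M > 0" "\<And>k. norm (w powi (int k - l) * b k) \<le> M"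
    by (auto simp: Bseq_def)
  define N where "N = M * norm w powi l"
  have b: "norm (b k) * norm w ^ k \<le> N" for k
  proof -
    have "norm (b k) * norm w ^ k = norm (w powi (int k - l) * b k) * norm w powi l"
      using w by (simp add: norm_mult norm_power_int power_int_diff)
    also have "\<dots> \<le> N"
      unfolding N_def by (intro mult_right_mono M) simp
    finally show ?thesis .
  qed
  have "norm t * norm v powi l \<le> 2 * N"
    if v: "v \<noteq> 0" "norm v \<le> norm w / 2" and t: "((\<lambda>n. v powi n * a n) has_sum t) UNIV" for v t
  proof -
    have N: "N \<ge> 0"
      using M by (simp add: N_def)
    have le: "norm (v powi (int k - l) * b k) * norm v powi l \<le> N * (1 / 2) ^ k" for k
    proof -
      have "norm (v powi (int k - l) * b k) * norm v powi l = norm (b k) * norm v ^ k"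
        using v by (simp add: norm_mult norm_power_int power_int_diff)
      also have "\<dots> \<le> norm (b k) * (norm w / 2) ^ k"
        by (intro mult_left_mono power_mono v) auto
      also have "\<dots> = norm (b k) * norm w ^ k * (1 / 2) ^ k"
        by (simp add: power_divide)
      also have "\<dots> \<le> N * (1 / 2) ^ k"
        by (intro mult_right_mono b) simp
      finally show ?thesis .
    qed
    have "norm (\<Sum>k<n. v powi (int k - l) * b k) * norm v powi l \<le> 2 * N" for n
    proof -
      have "norm (\<Sum>k<n. v powi (int k - l) * b k) * norm v powi l
          \<le> (\<Sum>k<n. norm (v powi (int k - l) * b k)) * norm v powi l"
        by (intro mult_right_mono norm_sum) simp
      also have "\<dots> \<le> (\<Sum>k<n. N * (1 / 2) ^ k)"
        unfolding sum_distrib_right by (intro sum_mono le)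
      also have "\<dots> = N * (\<Sum>k<n. (1 / 2) ^ k)"
        by (simp add: sum_distrib_left)
      also have "\<dots> \<le> N * 2"
        by (intro mult_left_mono N) (simp add: sum_gp_strict)
      finally show ?thesis
        by simp
    qed
    moreover have "(\<lambda>n. norm (\<Sum>k<n. v powi (int k - l) * b k) * norm v powi l)
        \<longlonglongrightarrow> norm t * norm v powi l"
      using sums[OF t] unfolding sums_def by (intro tendsto_intros)
    ultimately show ?thesis
      by (intro LIMSEQ_le_const2[where a = "2 * N"]) auto
  qed
  then show ?thesis
    by blast
qed

text \<open>By Riemann's theorem on removable singularities, applied to \<open>F z * (z - z0) powi l\<close>.\<close>

lemma meromorphic_at_if_bounded_powi:
  assumes F: "F holomorphic_on ball z0 R - {z0}" and R: "R > 0"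
    and bound: "\<And>z. z \<noteq> z0 \<Longrightarrow> dist z z0 < R \<Longrightarrow> norm (F z) * norm (z - z0) powi l \<le> M"
  shows "F meromorphic_on {z0}"
proof -
  define G where "G = (\<lambda>z. F z * (z - z0) powi l)"
  have "G holomorphic_on ball z0 R - {z0}"
    unfolding G_def by (intro holomorphic_intros F) auto
  moreover have "\<forall>\<^sub>F z in at z0. norm (G z) \<le> M"
    unfolding eventually_at using R bound
    by (auto simp: G_def norm_mult norm_power_int intro!: exI[of _ R])
  ultimately obtain g where g: "g holomorphic_on ball z0 R" "\<And>z. z \<in> ball z0 R - {z0} \<Longrightarrow> g z = G z"
    using holomorphic_on_extend_bounded[of G "ball z0 R" z0] R
    by (auto simp: interior_open)
  have "(\<lambda>z. g z * (z - z0) powi (- l)) meromorphic_on {z0}"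
    using g(1) R by (intro meromorphic_intros analytic_on_imp_meromorphic_on)
      (auto intro: holomorphic_on_imp_analytic_at)
  moreover have "\<forall>\<^sub>F z in at z0. z \<in> ball z0 R - {z0}"
    using R by (intro eventually_at_in_open) auto
  then have "\<forall>\<^sub>F z in at z0. g z * (z - z0) powi (- l) = F z"
    by eventually_elim (use g(2) in \<open>auto simp: G_def power_int_minus field_simps\<close>)
  ultimately show ?thesis
    by (subst meromorphic_on_cong[of _ F "\<lambda>z. g z * (z - z0) powi (- l)"]) (auto simp: eq_commute)
qed

section \<open>Intrinsic functions and slice preserving functions\<close>

definition intrinsic_on :: "complex set \<Rightarrow> (complex \<Rightarrow> complex) \<Rightarrow> bool" where
  "intrinsic_on \<Omega> F \<longleftrightarrow> F holomorphic_on \<Omega> \<and> (\<forall>z\<in>\<Omega>. cnj z \<in> \<Omega> \<and> F (cnj z) = cnj (F z))"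

text \<open>The sets \<open>half_coord -` \<Omega>\<close>, with \<open>\<Omega>\<close> symmetric about the real axis, are the axially symmetric
  sets of quaternions; \<open>f\<close> acts on every slice by the same complex function \<open>F\<close>.\<close>

definition induced_by :: "complex set \<Rightarrow> (complex \<Rightarrow> complex) \<Rightarrow> quat set \<Rightarrow> (quat \<Rightarrow> quat) \<Rightarrow> bool" where
  "induced_by \<Omega> F A f \<longleftrightarrow>
     A = half_coord -` \<Omega> \<and> (\<forall>I\<in>imag_units. \<forall>z\<in>\<Omega>. f (slice_embed I z) = slice_embed I (F z))"

text \<open>The complex functions that correspond to slice preserving semiregular functions on all
  quaternions. The domain \<open>\<Omega>\<close> may omit removable singularities besides the poles; outside
  \<open>\<Omega>\<close> the values of \<open>F\<close> are arbitrary.\<close>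

definition semiregular_stem :: "complex set \<Rightarrow> (complex \<Rightarrow> complex) \<Rightarrow> bool" where
  "semiregular_stem \<Omega> F \<longleftrightarrow> - \<Omega> sparse_in UNIV \<and> intrinsic_on \<Omega> F \<and> F meromorphic_on UNIV"

lemma half_coord_embed_in_iff:
  assumes "intrinsic_on \<Omega> F" "I \<in> imag_units"
  shows "half_coord (slice_embed I z) \<in> \<Omega> \<longleftrightarrow> z \<in> \<Omega>"
  using assms unfolding half_coord_embed[OF assms(2)] intrinsic_on_def
  by (metis complex_cnj_cnj)

lemma semiregular_stem_open: "semiregular_stem \<Omega> F \<Longrightarrow> open \<Omega>"
  using sparse_in_UNIV_imp_closed[of "- \<Omega>"] by (simp add: semiregular_stem_def open_closed)

text \<open>On each slice the function is a holomorphic function of the slice coordinate. All these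
  functions have the same values on the real axis, where the slices meet, so the identity theorem on
  the connected set \<open>\<Omega>\<close> makes them equal. Conjugation symmetry comes from comparing the slices of \<open>I\<close>
  and \<open>- I\<close>, which are the same plane with conjugate coordinates.\<close>

lemma symmetric_slice_domain_stem:
  assumes A: "symmetric_slice_domain A" and f: "regular_on A f" "slice_preserving_on A f"
  shows "\<exists>F. intrinsic_on (slice_embed std_unit -` A) F \<and>
    induced_by (slice_embed std_unit -` A) F A f"
proof -
  define \<Omega> where "\<Omega> = slice_embed std_unit -` A"
  have openA: "open A"
    using A by (simp add: symmetric_slice_domain_def)
  have mem: "slice_embed I z \<in> A \<longleftrightarrow> z \<in> \<Omega>" if "I \<in> imag_units" for I z
  proof -
    have "slice_embed K z \<in> A" if "slice_embed J z \<in> A" "J \<in> imag_units" "K \<in> imag_units" for J K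
      using A that unfolding symmetric_slice_domain_def slice_embed_def by blast
    then show ?thesis
      using that by (auto simp: \<Omega>_def)
  qed
  have "q \<in> A \<longleftrightarrow> q \<in> half_coord -` \<Omega>" for q
    using mem[of "axis_unit q" "half_coord q"] by simp
  then have A_eq: "A = half_coord -` \<Omega>"
    by blast
  have "open \<Omega>"
    unfolding \<Omega>_def by (rule open_vimage_slice_embed[OF _ openA]) simp
  have \<Omega>_image: "\<Omega> = slice_coord std_unit ` (A \<inter> slice_plane std_unit)"
  proof
    show "\<Omega> \<subseteq> slice_coord std_unit ` (A \<inter> slice_plane std_unit)"
    proof
      fix z assume "z \<in> \<Omega>"
      then show "z \<in> slice_coord std_unit ` (A \<inter> slice_plane std_unit)"
        by (intro image_eqI[of _ _ "slice_embed std_unit z"]) (auto simp: \<Omega>_def slice_plane_eq)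
    qed
  qed (auto simp: \<Omega>_def slice_plane_eq)
  have "connected \<Omega>"
    unfolding \<Omega>_image using A
    by (intro connected_continuous_image linear_continuous_on bounded_linear_slice_coord)
      (auto simp: symmetric_slice_domain_def)
  define S where "S = (\<lambda>I z. slice_coord I (f (slice_embed I z)))"
  have S_hol: "S I holomorphic_on \<Omega>" if "I \<in> imag_units" for I
  proof -
    have "slice_embed I -` A = \<Omega>"
      using mem[OF that] by auto
    then show ?thesis
      using regular_on_imp_holomorphic_slice_coord[OF openA f(1) that] by (simp add: S_def)
  qed
  have S: "f (slice_embed I z) = slice_embed I (S I z)" if "I \<in> imag_units" "z \<in> \<Omega>" for I z
  proof -
    have "slice_embed I z \<in> A \<inter> slice_plane I"
      using that mem by (auto simp: slice_plane_eq)
    then have "f (slice_embed I z) \<in> slice_plane I"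
      using f(2) that unfolding slice_preserving_on_def by blast
    then show ?thesis
      using that by (simp add: S_def slice_embed_coord)
  qed
  define J where "J = Quat 0 0 1 0"
  have J: "J \<in> imag_units"
    by (simp add: J_def imag_units_iff)
  \<comment> \<open>A real point lies on every slice, so its value lies in the intersection of all slices,
      which is the real axis.\<close>
  have S_real: "S I x = S std_unit x" if I: "I \<in> imag_units" and x: "x \<in> \<Omega>" "x \<in> \<real>" for I x
  proof -
    have e: "slice_embed K x = of_real (Re x)" for K
      using x(2) by (auto simp: quat_eq_iff elim: Reals_cases)
    let ?v = "f (of_real (Re x))"
    have "?v = slice_embed std_unit (S std_unit x)" "?v = slice_embed J (S J x)"
      using S[of std_unit x] S[of J x] x J by (simp_all add: e)
    then have "qI ?v = 0 \<and> qJ ?v = 0 \<and> qK ?v = 0"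
      by (simp add: quat_eq_iff J_def std_unit_def)
    then show ?thesis
      by (simp add: S_def e complex_eq_iff)
  qed
  obtain x0 where x0: "of_real x0 \<in> A"
    using A by (auto simp: symmetric_slice_domain_def elim!: Reals_cases)
  have "slice_embed std_unit (of_real x0) = of_real x0"
    by (simp add: quat_eq_iff std_unit_def)
  then have x0\<Omega>: "of_real x0 \<in> \<Omega>"
    using x0 by (simp add: \<Omega>_def)
  have lim: "of_real x0 islimpt \<Omega> \<inter> \<real>"
    unfolding islimpt_approachable
  proof (intro allI impI)
    fix e :: real assume "e > 0"
    obtain d where d: "d > 0" "ball (of_real x0) d \<subseteq> \<Omega>"
      using \<open>open \<Omega>\<close> x0\<Omega> by (meson open_contains_ball)
    define r where "r = min d e / 2"
    have r: "0 < r" "r < d" "r < e"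
      using d \<open>e > 0\<close> by (auto simp: r_def)
    have "dist (complex_of_real (x0 + r)) (of_real x0) = r"
      using r by (simp add: dist_norm)
    then show "\<exists>x'\<in>\<Omega> \<inter> \<real>. x' \<noteq> complex_of_real x0 \<and> dist x' (complex_of_real x0) < e"
      using r d by (intro bexI[of _ "of_real (x0 + r)"]) (auto simp: dist_commute)
  qed
  have S_indep: "S I z = S std_unit z" if I: "I \<in> imag_units" and z: "z \<in> \<Omega>" for I z
  proof -
    have "S I z - S std_unit z = 0"
    proof (rule analytic_continuation[where f = "\<lambda>z. S I z - S std_unit z", OF _ \<open>open \<Omega>\<close> \<open>connected \<Omega>\<close> _ x0\<Omega> lim])
      show "(\<lambda>z. S I z - S std_unit z) holomorphic_on \<Omega>"
        by (intro holomorphic_intros S_hol I) simp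
    qed (use S_real[OF I] z in auto)
    then show ?thesis
      by simp
  qed
  define F where "F = S std_unit"
  have fF: "f (slice_embed I z) = slice_embed I (F z)" if "I \<in> imag_units" "z \<in> \<Omega>" for I z
    using S[OF that] S_indep[OF that] by (simp add: F_def)
  have "cnj z \<in> \<Omega> \<and> F (cnj z) = cnj (F z)" if "z \<in> \<Omega>" for z
  proof -
    have u: "- std_unit \<in> imag_units"
      by (simp add: imag_units_uminus)
    have c: "cnj z \<in> \<Omega>"
      using mem[OF u, of z] that by (simp add: \<Omega>_def slice_embed_cnj)
    have "slice_embed std_unit (F (cnj z)) = f (slice_embed (- std_unit) z)"
      using fF[OF _ c, of std_unit] by (simp add: slice_embed_cnj)
    also have "\<dots> = slice_embed std_unit (cnj (F z))"
      using fF[OF u that] by (simp add: slice_embed_cnj)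
    finally show ?thesis
      using c by simp
  qed
  moreover have "F holomorphic_on \<Omega>"
    using S_hol by (simp add: F_def)
  ultimately have "intrinsic_on \<Omega> F"
    by (simp add: intrinsic_on_def)
  moreover have "induced_by \<Omega> F A f"
    using A_eq fF by (simp add: induced_by_def)
  ultimately show ?thesis
    unfolding \<Omega>_def by blast
qed

text \<open>It suffices to look at a single slice. A singularity of the quaternionic function there has a
  punctured disc in the domain, so the complement of \<open>\<Omega>\<close> is sparse; at a removable singularity \<open>F\<close>
  agrees with a holomorphic function, and at a pole it grows at most like a power.\<close>

lemma semiregular_reps_imp_stem:
  assumes "(A, f) \<in> semiregular_reps UNIV"
  shows "\<exists>\<Omega> F. semiregular_stem \<Omega> F \<and> induced_by \<Omega> F A f"
proof -
  have A: "symmetric_slice_domain A" "regular_on A f" "slice_preserving_on A f"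
    and sing: "\<And>p I. p \<notin> A \<Longrightarrow> I \<in> imag_units \<Longrightarrow> p \<in> slice_plane I \<Longrightarrow>
      pole_singularity A f I p \<or> removable_singularity A f I p"
    using assms by (auto simp: semiregular_reps_def)
  let ?e = "slice_embed std_unit"
  define \<Omega> where "\<Omega> = ?e -` A"
  obtain F where F: "intrinsic_on \<Omega> F" "induced_by \<Omega> F A f"
    using symmetric_slice_domain_stem[OF A] unfolding \<Omega>_def by blast
  have fF: "slice_coord std_unit (f (?e z)) = F z" if "z \<in> \<Omega>" for z
    using F(2) that by (simp add: induced_by_def)
  have "open \<Omega>"
    unfolding \<Omega>_def using A(1)
    by (intro open_vimage_slice_embed) (auto simp: symmetric_slice_domain_def)
  have hol: "F holomorphic_on \<Omega>"
    using F(1) by (simp add: intrinsic_on_def)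
  have disc: "z \<in> \<Omega>" if "punctured_slice_disc std_unit (?e p) R \<subseteq> A" "0 < dist z p" "dist z p < R" for z p R
  proof -
    have "?e z \<in> punctured_slice_disc std_unit (?e p) R"
      using that by (simp add: punctured_slice_disc_def slice_plane_eq)
    then show ?thesis
      using that by (auto simp: \<Omega>_def)
  qed
  have sing_at: "(\<forall>\<^sub>F w in at z. w \<in> \<Omega>) \<and> F meromorphic_on {z}" for z
  proof (cases "z \<in> \<Omega>")
    case True
    then show ?thesis
      using \<open>open \<Omega>\<close> hol
      by (auto intro!: eventually_at_in_open' analytic_on_imp_meromorphic_on
          intro: holomorphic_on_imp_analytic_at)
  next
    case False
    let ?p = "?e z"
    have sing: "pole_singularity A f std_unit ?p \<or> removable_singularity A f std_unit ?p"
      using False by (intro sing) (auto simp: \<Omega>_def slice_plane_eq)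
    then obtain R where R: "R > 0" "punctured_slice_disc std_unit ?p R \<subseteq> A"
      by (auto simp: pole_singularity_def removable_singularity_def slice_singularity_def)
    have "\<forall>\<^sub>F w in at z. w \<in> \<Omega>"
      unfolding eventually_at using disc[OF R(2)] R(1) by (auto intro!: exI[of _ R])
    moreover have "F meromorphic_on {z}"
      using sing
    proof
      assume "removable_singularity A f std_unit ?p"
      then obtain U g where U: "open U" "?p \<in> U" "regular_on U g" "\<forall>q\<in>A \<inter> U. g q = f q"
        by (auto simp: removable_singularity_def)
      define G where "G = (\<lambda>w. slice_coord std_unit (g (?e w)))"
      have "G holomorphic_on (?e -` U)"
        unfolding G_def by (rule regular_on_imp_holomorphic_slice_coord) (use U in auto)
      moreover have opn: "open (?e -` U)" "z \<in> ?e -` U"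
        using U by (auto intro: open_vimage_slice_embed)
      ultimately have "G meromorphic_on {z}"
        by (intro analytic_on_imp_meromorphic_on holomorphic_on_imp_analytic_at)
      moreover have "\<forall>\<^sub>F w in at z. w \<in> ?e -` U"
        using opn by (rule eventually_at_in_open')
      with \<open>\<forall>\<^sub>F w in at z. w \<in> \<Omega>\<close> have "\<forall>\<^sub>F w in at z. G w = F w"
        by eventually_elim (use U(4) fF in \<open>auto simp: G_def \<Omega>_def\<close>)
      ultimately show ?thesis
        by (subst (asm) meromorphic_on_cong) auto
    next
      assume "pole_singularity A f std_unit ?p"
      then obtain R a l where R: "R > 0" "punctured_slice_disc std_unit ?p R \<subseteq> A"
        and a: "laurent_expansion_at f std_unit ?p R a" "\<forall>n>l. a (- n) = 0"
        by (auto simp: pole_singularity_def)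
      have sum: "((\<lambda>n. ?e w powi n * a n) has_sum ?e (F (z + w))) UNIV"
        if "w \<noteq> 0" "norm w < R" for w
      proof -
        have d: "0 < dist (z + w) z" "dist (z + w) z < R"
          using that by (auto simp: dist_norm)
        have "z + w \<in> \<Omega>"
          using disc[OF R(2) d] .
        then have "f (?e (z + w)) = ?e (F (z + w))"
          using F(2) by (simp add: induced_by_def)
        moreover have "?e (z + w) \<in> punctured_slice_disc std_unit ?p R"
          using d by (simp add: punctured_slice_disc_def slice_plane_eq)
        ultimately show ?thesis
          using a(1) unfolding laurent_expansion_at_def
          by (fastforce simp flip: slice_embed_diff)
      qed
      define w where "w = complex_of_real (R / 2)"
      have w: "w \<noteq> 0" "norm w = R / 2"
        using R by (auto simp: w_def)
      have "((\<lambda>n. ?e w powi n * a n) has_sum ?e (F (z + w))) UNIV"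
        using sum[of w] w R by simp
      from finite_principal_part_bounded[OF _ this, of l] obtain M where
        M: "\<And>v t. v \<noteq> 0 \<Longrightarrow> norm v \<le> norm w / 2 \<Longrightarrow> ((\<lambda>n. v powi n * a n) has_sum t) UNIV \<Longrightarrow>
          norm t * norm v powi l \<le> M"
        using w a(2) by auto
      show ?thesis
      proof (rule meromorphic_at_if_bounded_powi)
        show "F holomorphic_on ball z (R / 4) - {z}"
        proof (rule holomorphic_on_subset[OF hol], rule subsetI)
          fix v assume "v \<in> ball z (R / 4) - {z}"
          then have "0 < dist v z" "dist v z < R"
            using R(1) by (auto simp: dist_commute)
          then show "v \<in> \<Omega>"
            by (rule disc[OF R(2)])
        qed
        show "norm (F v) * norm (v - z) powi l \<le> M" if "v \<noteq> z" "dist v z < R / 4" for v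
          using M[of "?e (v - z)" "?e (F v)"] sum[of "v - z"] that w R(1)
          by (auto simp: dist_norm)
      qed (use R in auto)
    qed
    ultimately show ?thesis
      by blast
  qed
  then have "- \<Omega> sparse_in UNIV"
    by (simp add: sparse_in_eventually_iff)
  moreover have "F meromorphic_on UNIV"
    using sing_at by (subst meromorphic_on_meromorphic_at) blast
  ultimately show ?thesis
    using F unfolding semiregular_stem_def by blast
qed

text \<open>A sparse set is countable, so it neither disconnects the plane nor exhausts the real axis.
  Hence every slice of the domain is connected, and the slices share a real point.\<close>

lemma stem_symmetric_slice_domain:
  assumes "semiregular_stem \<Omega> F"
  shows "symmetric_slice_domain (half_coord -` \<Omega>)"
proof -
  let ?A = "half_coord -` \<Omega>"
  have sp: "- \<Omega> sparse_in UNIV" and F: "intrinsic_on \<Omega> F"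
    using assms by (auto simp: semiregular_stem_def)
  note mem = half_coord_embed_in_iff[OF F]
  have "open \<Omega>"
    using assms by (rule semiregular_stem_open)
  have openA: "open ?A"
    using \<open>open \<Omega>\<close> continuous_on_half_coord[of UNIV] by (simp add: continuous_on_open_vimage)
  have "connected \<Omega>"
    using sparse_imp_connected[OF _ connected_UNIV _ sp] by (simp add: Diff_eq)
  have slice: "?A \<inter> slice_plane I = slice_embed I ` \<Omega>" if "I \<in> imag_units" for I
    using mem[OF that] by (auto simp: slice_plane_eq)
  have conn: "connected (?A \<inter> slice_plane I)" if "I \<in> imag_units" for I
    unfolding slice[OF that]
    by (intro connected_continuous_image continuous_on_slice_embed that \<open>connected \<Omega>\<close>)
  have "countable (- \<Omega>)"
    using sparse_imp_countable[OF _ sp] by simp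
  then have "countable (complex_of_real ` (complex_of_real -` (- \<Omega>)))"
    by (rule countable_subset[rotated]) auto
  then have "countable (complex_of_real -` (- \<Omega>))"
    by (rule countable_image_inj_on)
      (auto simp: inj_on_def)
  then obtain x where x: "complex_of_real x \<in> \<Omega>"
  proof -
    have "complex_of_real -` (- \<Omega>) \<noteq> UNIV"
      using \<open>countable (complex_of_real -` (- \<Omega>))\<close> uncountable_UNIV_real by auto
    then show thesis
      using that by auto
  qed
  have real: "slice_embed I (of_real x) = of_real x" for I
    by (simp add: quat_eq_iff)
  have xA: "of_real x \<in> ?A \<inter> slice_plane I" if "I \<in> imag_units" for I
    using x mem[OF that, of "of_real x"] rangeI[of "slice_embed I" "of_real x"]
    by (simp add: real slice_plane_eq)
  have "?A = (\<Union>I\<in>imag_units. ?A \<inter> slice_plane I)"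
    by (auto simp: slice_plane_eq intro: quat_cases_slice)
  moreover have "connected (\<Union>I\<in>imag_units. ?A \<inter> slice_plane I)"
    using xA conn by (intro connected_Union) blast+
  ultimately have "connected ?A"
    by metis
  have "slice_point J a b \<in> ?A" if "slice_point I a b \<in> ?A" "I \<in> imag_units" "J \<in> imag_units" for I J a b
    using that mem by (simp add: slice_point_eq_embed)
  moreover have "openin (top_of_set (slice_plane I)) (?A \<inter> slice_plane I)" for I
    using openin_open_Int[OF openA, of "slice_plane I"] by (simp add: Int_commute)
  moreover have "of_real x \<in> ?A \<inter> \<real>"
    using xA[of std_unit] by auto
  ultimately show ?thesis
    unfolding symmetric_slice_domain_def
  proof (intro conjI ballI allI impI)
    show "?A \<inter> slice_plane I \<noteq> {}" if "I \<in> imag_units" for I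
      using xA[OF that] by blast
  qed (use openA \<open>connected ?A\<close> conn in auto)
qed

text \<open>A removable singularity of \<open>F\<close> also has a Laurent expansion with finite principal part. It is
  therefore enough to produce the expansion at each omitted point: whatever is not removable is then
  a pole by definition.\<close>

lemma stem_imp_semiregular_reps:
  assumes st: "semiregular_stem \<Omega> F" and ind: "induced_by \<Omega> F A f"
  shows "(A, f) \<in> semiregular_reps UNIV"
proof -
  have sp: "- \<Omega> sparse_in UNIV" and F: "intrinsic_on \<Omega> F" and mero: "F meromorphic_on UNIV"
    using st by (auto simp: semiregular_stem_def)
  have A: "A = half_coord -` \<Omega>" and fF: "\<And>I z. I \<in> imag_units \<Longrightarrow> z \<in> \<Omega> \<Longrightarrow> f (slice_embed I z) = slice_embed I (F z)"
    using ind by (auto simp: induced_by_def)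
  have mem: "slice_embed I z \<in> A \<longleftrightarrow> z \<in> \<Omega>" if "I \<in> imag_units" for I z
    using half_coord_embed_in_iff[OF F that] by (simp add: A)
  have hol: "F holomorphic_on \<Omega>"
    using F by (simp add: intrinsic_on_def)
  have dom: "symmetric_slice_domain A"
    unfolding A by (rule stem_symmetric_slice_domain[OF st])
  then have "open A"
    by (simp add: symmetric_slice_domain_def)
  have "slice_embed I -` A = \<Omega>" if "I \<in> imag_units" for I
    using mem[OF that] by auto
  then have reg: "regular_on A f"
    using \<open>open A\<close> hol fF mem by (intro regular_on_if_holomorphic[of A F]) auto
  have pres: "slice_preserving_on A f"
    unfolding slice_preserving_on_def
  proof (intro ballI subsetI)
    fix I q assume I: "I \<in> imag_units" and "q \<in> f ` (A \<inter> slice_plane I)"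
    then obtain z where "slice_embed I z \<in> A" "q = f (slice_embed I z)"
      by (auto simp: slice_plane_eq)
    then have "q = slice_embed I (F z)"
      using fF[OF I] mem[OF I] by simp
    then show "q \<in> slice_plane I"
      by (simp add: slice_plane_eq)
  qed
  have "pole_singularity A f I p \<or> removable_singularity A f I p"
    if p: "p \<notin> A" "I \<in> imag_units" "p \<in> slice_plane I" for p I
  proof -
    obtain z where z: "p = slice_embed I z"
      using p by (auto simp: slice_plane_eq)
    have "\<forall>\<^sub>F w in at z. w \<in> \<Omega>"
      using sp by (simp add: sparse_in_eventually_iff)
    then obtain R1 where R1: "R1 > 0" "\<And>w. w \<noteq> z \<Longrightarrow> dist w z < R1 \<Longrightarrow> w \<in> \<Omega>"
      by (auto simp: eventually_at)
    have "F meromorphic_on {z}"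
      using mero by (rule meromorphic_on_subset) simp
    from meromorphic_imp_laurent_series[OF this] obtain c l R2 where
      c': "l \<ge> 0 \<and> (\<forall>n>l. c (- n) = 0) \<and> R2 > 0 \<and> (\<forall>w. 0 < dist w z \<and> dist w z < R2 \<longrightarrow>
        ((\<lambda>n. (w - z) powi n * c n) has_sum F w) UNIV)"
      by (elim exE)
    then have c: "l \<ge> 0" "\<forall>n>l. c (- n) = 0" "R2 > 0"
      by blast+
    define R where "R = min R1 R2"
    have "R > 0"
      using R1 c by (simp add: R_def)
    have disc: "punctured_slice_disc I p R = slice_embed I ` {w. 0 < dist w z \<and> dist w z < R}"
      using p(2) by (auto simp: punctured_slice_disc_def slice_plane_eq z)
    have sub: "punctured_slice_disc I p R \<subseteq> A"
      unfolding disc using R1 mem[OF p(2)] by (auto simp: R_def)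
    have "laurent_expansion_at f I p R (\<lambda>n. slice_embed I (c n))"
      unfolding laurent_expansion_at_def disc
    proof safe
      fix w assume w: "0 < dist w z" "dist w z < R"
      have "((\<lambda>n. slice_embed I ((w - z) powi n * c n)) has_sum slice_embed I (F w)) UNIV"
        using c' w by (intro has_sum_bounded_linear[OF bounded_linear_slice_embed[OF p(2)]])
          (simp add: R_def)
      moreover have "f (slice_embed I w) = slice_embed I (F w)"
        using w R1 by (intro fF p) (auto simp: R_def)
      ultimately show "((\<lambda>n. (slice_embed I w - p) powi n * slice_embed I (c n)) has_sum f (slice_embed I w)) UNIV"
        by (simp add: z slice_embed_mult[OF p(2)] slice_embed_power_int[OF p(2)] slice_embed_diff)
    qed
    moreover have "\<exists>l\<ge>0. \<forall>n>l. slice_embed I (c (- n)) = 0"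
      using c(1,2) by (intro exI[of _ l]) simp
    moreover have "slice_singularity A I p"
      unfolding slice_singularity_def using p \<open>R > 0\<close> sub by blast
    ultimately show ?thesis
      unfolding pole_singularity_def using \<open>R > 0\<close> sub by (intro disjCI) blast
  qed
  then show ?thesis
    unfolding semiregular_reps_def using dom reg pres by blast
qed

section \<open>Intrinsic meromorphic functions as quotients\<close>

lemma eq_off_sparse_imp_eq:
  fixes f g :: "complex \<Rightarrow> complex"
  assumes sp: "- \<Omega> sparse_in UNIV" and S: "open S" "continuous_on S f" "continuous_on S g"
    and eq: "\<And>z. z \<in> S \<Longrightarrow> z \<in> \<Omega> \<Longrightarrow> f z = g z" and z: "z \<in> S"
  shows "f z = g z"
proof -
  have "\<forall>\<^sub>F w in at z. w \<in> \<Omega>"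
    using sp by (simp add: sparse_in_eventually_iff)
  moreover have "\<forall>\<^sub>F w in at z. w \<in> S"
    using S(1) z by (rule eventually_at_in_open')
  ultimately have "\<forall>\<^sub>F w in at z. f w = g w"
    by eventually_elim (rule eq)
  moreover have "(f \<longlongrightarrow> f z) (at z)" "(g \<longlongrightarrow> g z) (at z)"
    using S z by (simp_all add: continuous_on_eq_continuous_at isContD)
  ultimately have "(g \<longlongrightarrow> f z) (at z)"
    using tendsto_cong by blast
  with \<open>(g \<longlongrightarrow> g z) (at z)\<close> show ?thesis
    using tendsto_unique[OF at_neq_bot] by blast
qed

lemma holomorphic_mult_eq_0:
  assumes f: "f holomorphic_on UNIV" and g: "g holomorphic_on UNIV" and fg: "\<And>z. f z * g z = 0"
  shows "(\<forall>z. f z = 0) \<or> (\<forall>z. g z = 0)"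
proof (rule disjCI)
  assume "\<not> (\<forall>z. g z = 0)"
  then obtain z0 where "g z0 \<noteq> 0"
    by blast
  have "continuous_on UNIV g"
    using g by (rule holomorphic_on_imp_continuous_on)
  then have "open {z. g z \<noteq> 0}"
    by (intro open_Collect_neq continuous_on_const)
  then have "f z = 0" for z
    by (rule analytic_continuation_open[of "{z. g z \<noteq> 0}" UNIV f "\<lambda>_. 0"])
      (use f fg \<open>g z0 \<noteq> 0\<close> in auto)
  then show "\<forall>z. f z = 0"
    by blast
qed

definition reflect :: "(complex \<Rightarrow> complex) \<Rightarrow> complex \<Rightarrow> complex" where
  "reflect f z = cnj (f (cnj z))"

lemma holomorphic_reflect:
  assumes "f holomorphic_on UNIV"
  shows "reflect f holomorphic_on UNIV"
proof -
  have "cnj \<circ> f \<circ> cnj holomorphic_on UNIV"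
    by (rule holomorphic_on_compose_cnj_cnj) (use assms holomorphic_on_subset in auto)
  then show ?thesis
    by (simp add: reflect_def[abs_def] o_def)
qed

lemma reflect_eq_imp_intrinsic:
  "f holomorphic_on UNIV \<Longrightarrow> reflect f = f \<Longrightarrow> intrinsic_on UNIV f"
  unfolding intrinsic_on_def reflect_def fun_eq_iff by (metis UNIV_I complex_cnj_cnj)

text \<open>The factor is a square root of \<open>u\<close>, which exists because \<open>u\<close> has no zeros. The function
  \<open>p = s * reflect s\<close> satisfies \<open>p\<^sup>2 = u * reflect u = 1\<close>, so it is one of the constants \<open>1\<close> and \<open>- 1\<close>,
  and it is nonnegative on the real axis.\<close>

lemma symmetrizing_factor:
  assumes u: "u holomorphic_on UNIV" and uu: "\<And>z. u z * reflect u z = 1"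
  obtains s where "s holomorphic_on UNIV" "\<And>z. s z \<noteq> 0" "\<And>z. u z * reflect s z = s z"
proof -
  have "u z \<noteq> 0" for z
    using uu[of z] by auto
  then obtain w where w: "w holomorphic_on UNIV" "\<And>z. exp (w z) = u z"
    using holomorphic_logarithm_exists[of UNIV u 0] u by auto
  define s where "s = (\<lambda>z. exp (w z / 2))"
  have s: "s holomorphic_on UNIV" "\<And>z. s z \<noteq> 0"
    unfolding s_def by (auto intro!: holomorphic_intros w)
  have s2: "s z * s z = u z" for z
    using w(2)[of z] by (simp add: s_def flip: exp_add)
  define p where "p = (\<lambda>z. s z * reflect s z)"
  have p: "p holomorphic_on UNIV"
    unfolding p_def by (intro holomorphic_intros s holomorphic_reflect)
  have "(p z - 1) * (p z + 1) = 0" for z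
  proof -
    have "p z * p z = u z * reflect u z"
      using s2[of z] s2[of "cnj z"] by (simp add: p_def reflect_def mult_ac flip: complex_cnj_mult)
    then show ?thesis
      using uu[of z] by (simp add: algebra_simps)
  qed
  then have "(\<forall>z. p z - 1 = 0) \<or> (\<forall>z. p z + 1 = 0)"
    by (intro holomorphic_mult_eq_0 holomorphic_intros p)
  moreover have "p 0 + 1 \<noteq> 0"
  proof
    assume "p 0 + 1 = 0"
    then have "Re (p 0) = - 1"
      by (simp add: complex_eq_iff add_eq_0_iff)
    moreover have "Re (p 0) \<ge> 0"
      by (simp add: p_def reflect_def)
    ultimately show False
      by simp
  qed
  ultimately have p1: "s z * reflect s z = 1" for z
    unfolding p_def by (metis eq_iff_diff_eq_0)
  have "u z * reflect s z = s z" for z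
    using p1[of z] by (simp add: mult.assoc flip: s2)
  then show thesis
    using s that by blast
qed

text \<open>The Weierstrass factorization theorem writes \<open>F\<close> as \<open>a / b\<close> with entire functions without
  common zeros, but nothing makes \<open>a\<close> and \<open>b\<close> intrinsic. As \<open>F\<close> is intrinsic, \<open>reflect a / reflect b\<close>
  is another such representation, and since common zeros are excluded, the two representations differ by
  an entire factor \<open>u\<close> without zeros. Multiplying \<open>a\<close> and \<open>b\<close> by a symmetrizing factor for \<open>u\<close> makes
  both intrinsic without changing their zeros or their quotient.\<close>

lemma intrinsic_quotient:
  assumes "semiregular_stem \<Omega> F"
  obtains G g where "intrinsic_on UNIV G" "intrinsic_on UNIV g"
    "\<And>z. G z \<noteq> 0 \<or> g z \<noteq> 0" "\<And>z. z \<in> \<Omega> \<Longrightarrow> g z \<noteq> 0 \<and> F z = G z / g z"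
proof -
  have sp: "- \<Omega> sparse_in UNIV" and F: "intrinsic_on \<Omega> F" and mero: "F meromorphic_on UNIV"
    using assms by (auto simp: semiregular_stem_def)
  have "open \<Omega>"
    using assms by (rule semiregular_stem_open)
  obtain h f1 f2 where W: "h holomorphic_on UNIV" "f1 holomorphic_on UNIV" "f2 holomorphic_on UNIV"
    "\<And>z. f1 z = 0 \<longleftrightarrow> \<not> is_pole (remove_sings F) z \<and> remove_sings F z = 0"
    "\<And>z. f2 z = 0 \<longleftrightarrow> is_pole (remove_sings F) z"
    "\<And>z. h z \<noteq> 0" "\<And>z. remove_sings F z = h z * f1 z / f2 z"
    using weierstrass_factorization_meromorphic_UNIV[OF remove_sings_nicely_meromorphic[OF mero]]
    by (metis (no_types, lifting))
  define a where "a = (\<lambda>z. h z * f1 z)"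
  define b where "b = f2"
  have a: "a holomorphic_on UNIV" and b: "b holomorphic_on UNIV"
    using W(1-3) by (auto simp: a_def b_def intro: holomorphic_intros)
  have nz: "a z \<noteq> 0 \<or> b z \<noteq> 0" for z
    using W(4,5)[of z] W(6)[of z] by (auto simp: a_def b_def)
  have ab: "b z \<noteq> 0" "F z = a z / b z" if "z \<in> \<Omega>" for z
  proof -
    have "F analytic_on {z}"
      using F \<open>open \<Omega>\<close> that by (auto simp: intrinsic_on_def intro: holomorphic_on_imp_analytic_at)
    then have "remove_sings F z = F z" "\<not> is_pole (remove_sings F) z"
      using analytic_at_imp_no_pole remove_sings_analytic_on by auto
    then show "b z \<noteq> 0" "F z = a z / b z"
      using W(5,7) by (auto simp: a_def b_def)
  qed
  let ?a = "reflect a" and ?b = "reflect b"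
  note reflected = holomorphic_reflect[OF a] holomorphic_reflect[OF b]
  have cross: "a z * ?b z = ?a z * b z" for z
  proof (rule eq_off_sparse_imp_eq[where f = "\<lambda>z. a z * ?b z" and g = "\<lambda>z. ?a z * b z",
        OF sp open_UNIV])
    fix z assume z: "z \<in> \<Omega>"
    then have c: "cnj z \<in> \<Omega>" "cnj (F (cnj z)) = F z"
      using F by (auto simp: intrinsic_on_def)
    then have "?a z / ?b z = a z / b z" "?b z \<noteq> 0" "b z \<noteq> 0"
      using ab[OF z] ab[OF c(1)] by (auto simp: reflect_def)
    then show "a z * ?b z = ?a z * b z"
      by (simp add: field_simps)
  qed (intro holomorphic_on_imp_continuous_on holomorphic_intros a b reflected | simp)+
  have nz': "?a z \<noteq> 0 \<or> ?b z \<noteq> 0" for z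
    using nz[of "cnj z"] by (simp add: reflect_def)
  \<comment> \<open>The two formulas agree where both denominators are nonzero, by \<open>cross\<close>, and their domains
      cover the plane.\<close>
  define u where "u = (\<lambda>z. if b z \<noteq> 0 then ?b z / b z else ?a z / a z)"
  have ub: "b z * u z = ?b z" and ua: "a z * u z = ?a z" for z
    using cross[of z] nz[of z] nz'[of z] by (auto simp: u_def field_simps)
  have u: "u holomorphic_on UNIV"
  proof -
    have opn: "open {z. b z \<noteq> 0}" "open {z. a z \<noteq> 0}"
      using a b holomorphic_on_imp_continuous_on by (intro open_Collect_neq continuous_on_const; blast)+
    have "(\<lambda>z. ?b z / b z) holomorphic_on {z. b z \<noteq> 0}"
      by (intro holomorphic_intros holomorphic_on_subset[OF reflected(2)] holomorphic_on_subset[OF b]) auto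
    then have "u holomorphic_on {z. b z \<noteq> 0}"
      by (rule holomorphic_transform) (simp add: u_def)
    moreover have "(\<lambda>z. ?a z / a z) holomorphic_on {z. a z \<noteq> 0}"
      by (intro holomorphic_intros holomorphic_on_subset[OF reflected(1)] holomorphic_on_subset[OF a]) auto
    then have "u holomorphic_on {z. a z \<noteq> 0}"
      by (rule holomorphic_transform) (use ua in \<open>auto simp: field_simps\<close>)
    ultimately have "u holomorphic_on {z. b z \<noteq> 0} \<union> {z. a z \<noteq> 0}"
      using opn by (intro holomorphic_on_Un)
    moreover have "{z. b z \<noteq> 0} \<union> {z. a z \<noteq> 0} = UNIV"
      using nz by auto
    ultimately show ?thesis
      by simp
  qed
  have "u z * reflect u z = 1" for z
  proof -
    have "?a z * reflect u z = a z" "?b z * reflect u z = b z"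
      using arg_cong[OF ua[of "cnj z"], of cnj] arg_cong[OF ub[of "cnj z"], of cnj]
      by (simp_all add: reflect_def)
    then have "a z * (u z * reflect u z) = a z" "b z * (u z * reflect u z) = b z"
      by (metis ua ub mult.assoc)+
    then show ?thesis
      using nz[of z] by auto
  qed
  from symmetrizing_factor[OF u this] obtain s where s: "s holomorphic_on UNIV" "\<And>z. s z \<noteq> 0"
    "\<And>z. u z * reflect s z = s z"
    by blast
  have sym: "intrinsic_on UNIV (\<lambda>z. f z * s z)"
    if f: "f holomorphic_on UNIV" "\<And>z. f z * u z = reflect f z" for f
  proof (rule reflect_eq_imp_intrinsic)
    have "reflect f z * reflect s z = f z * s z" for z
      using s(3)[of z] f(2)[of z] by (metis mult.assoc)
    then show "reflect (\<lambda>z. f z * s z) = (\<lambda>z. f z * s z)"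
      by (simp add: reflect_def fun_eq_iff)
  qed (intro holomorphic_intros f s)
  show thesis
  proof (rule that)
    show "intrinsic_on UNIV (\<lambda>z. a z * s z)" "intrinsic_on UNIV (\<lambda>z. b z * s z)"
      using sym a b ua ub by auto
  qed (use nz ab s(2) in auto)
qed

section \<open>The field of semiregular functions\<close>

definition slice_lift :: "(complex \<Rightarrow> complex) \<Rightarrow> quat \<Rightarrow> quat" where
  "slice_lift F q = slice_embed (axis_unit q) (F (half_coord q))"

text \<open>The lift uses the coordinate in the upper half plane. A point whose given coordinate \<open>z\<close> lies in
  the lower half plane is also \<open>cnj z\<close> on the slice of \<open>- I\<close>, and at a real point \<open>F\<close> is real, so that
  the chosen unit does not matter.\<close>

lemma induced_by_slice_lift:
  assumes "intrinsic_on \<Omega> F"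
  shows "induced_by \<Omega> F (half_coord -` \<Omega>) (slice_lift F)"
  unfolding induced_by_def
proof (intro conjI refl ballI)
  fix I z assume I: "I \<in> imag_units" and z: "z \<in> \<Omega>"
  let ?q = "slice_embed I z"
  have unit_eq: "J = K" if "slice_embed J w = slice_embed K w" "Im w \<noteq> 0"
    "J \<in> imag_units" "K \<in> imag_units" for J K w
    using that by (simp add: quat_eq_iff imag_units_iff)
  have q: "slice_embed (axis_unit ?q) (half_coord ?q) = ?q"
    by simp
  consider "Im z = 0" | "Im z > 0" | "Im z < 0"
    by linarith
  then show "slice_lift F ?q = slice_embed I (F z)"
  proof cases
    case 1
    then have "cnj z = z"
      by (simp add: complex_eq_iff)
    then have "F z = cnj (F z)"
      using assms z unfolding intrinsic_on_def by metis
    then have "Im (F z) = Im (cnj (F z))"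
      by (rule arg_cong)
    then have "slice_embed J (F z) = slice_embed I (F z)" for J
      by (simp add: quat_eq_iff)
    then show ?thesis
      using 1 by (simp add: slice_lift_def half_coord_embed[OF I])
  next
    case 2
    then have "axis_unit ?q = I"
      using q 2 I unfolding half_coord_embed[OF I] by - (rule unit_eq[of _ z], simp_all)
    then show ?thesis
      using 2 by (simp add: slice_lift_def half_coord_embed[OF I])
  next
    case 3
    have "axis_unit ?q = - I"
    proof (rule unit_eq[of _ "cnj z"])
      show "slice_embed (axis_unit ?q) (cnj z) = slice_embed (- I) (cnj z)"
        using q 3 unfolding half_coord_embed[OF I] by (simp flip: slice_embed_cnj)
    qed (use 3 I in \<open>auto simp: imag_units_uminus\<close>)
    moreover have "F (cnj z) = cnj (F z)"
      using assms z by (simp add: intrinsic_on_def)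
    ultimately show ?thesis
      using 3 by (simp add: slice_lift_def half_coord_embed[OF I] flip: slice_embed_cnj)
  qed
qed

lemma induced_by_mem_iff:
  assumes "intrinsic_on \<Omega> F" "induced_by \<Omega> F A f" "I \<in> imag_units"
  shows "slice_embed I z \<in> A \<longleftrightarrow> z \<in> \<Omega>"
  using half_coord_embed_in_iff[OF assms(1,3)] assms(2) by (simp add: induced_by_def)

lemma induced_by_eq_iff:
  assumes F: "intrinsic_on \<Omega> F" "induced_by \<Omega> F A f" and G: "intrinsic_on \<Omega>' G" "induced_by \<Omega>' G B g"
  shows "(\<forall>q\<in>A \<inter> B. f q = g q) \<longleftrightarrow> (\<forall>z\<in>\<Omega> \<inter> \<Omega>'. F z = G z)"
proof
  assume *: "\<forall>q\<in>A \<inter> B. f q = g q"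
  show "\<forall>z\<in>\<Omega> \<inter> \<Omega>'. F z = G z"
  proof
    fix z assume z: "z \<in> \<Omega> \<inter> \<Omega>'"
    then have "slice_embed std_unit z \<in> A \<inter> B"
      using induced_by_mem_iff[OF F] induced_by_mem_iff[OF G] by simp
    then have "f (slice_embed std_unit z) = g (slice_embed std_unit z)"
      using * by blast
    then have "slice_embed std_unit (F z) = slice_embed std_unit (G z)"
      using z F(2) G(2) by (simp add: induced_by_def)
    then show "F z = G z"
      by simp
  qed
next
  assume *: "\<forall>z\<in>\<Omega> \<inter> \<Omega>'. F z = G z"
  show "\<forall>q\<in>A \<inter> B. f q = g q"
  proof
    fix q assume q: "q \<in> A \<inter> B"
    obtain I z where "I \<in> imag_units" "q = slice_embed I z"
      by (rule quat_cases_slice)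
    then show "f q = g q"
      using * q F(2) G(2) induced_by_mem_iff[OF F] induced_by_mem_iff[OF G]
      by (auto simp: induced_by_def)
  qed
qed

abbreviation "reps \<equiv> semiregular_reps UNIV"

abbreviation "frac_class \<equiv> Ms_class UNIV"

lemma reps_stemE:
  assumes "(A, f) \<in> reps"
  obtains \<Omega> F where "semiregular_stem \<Omega> F" "intrinsic_on \<Omega> F" "induced_by \<Omega> F A f"
  using assms semiregular_reps_imp_stem semiregular_stem_def by blast

text \<open>Transitivity is the only point: two functions that agree with a third one on its domain agree on
  the remaining points by continuity, because that domain omits a sparse set only.\<close>

lemma equiv_semiregular_rel: "equiv reps (semiregular_rel UNIV)"
proof (rule equivI)
  show "trans (semiregular_rel UNIV)"
  proof (rule transI)
    fix x y z assume xy: "(x, y) \<in> semiregular_rel UNIV" and yz: "(y, z) \<in> semiregular_rel UNIV"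
    obtain A f B g C h where eqs: "x = (A, f)" "y = (B, g)" "z = (C, h)"
      by (metis surj_pair)
    have reps: "(A, f) \<in> reps" "(B, g) \<in> reps" "(C, h) \<in> reps"
      and eq: "\<forall>q\<in>A \<inter> B. f q = g q" "\<forall>q\<in>B \<inter> C. g q = h q"
      using xy yz by (auto simp: semiregular_rel_def eqs)
    obtain \<Omega>1 F where F: "semiregular_stem \<Omega>1 F" "intrinsic_on \<Omega>1 F" "induced_by \<Omega>1 F A f"
      using reps(1) by (rule reps_stemE)
    obtain \<Omega>2 G where G: "semiregular_stem \<Omega>2 G" "intrinsic_on \<Omega>2 G" "induced_by \<Omega>2 G B g"
      using reps(2) by (rule reps_stemE)
    obtain \<Omega>3 H where H: "semiregular_stem \<Omega>3 H" "intrinsic_on \<Omega>3 H" "induced_by \<Omega>3 H C h"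
      using reps(3) by (rule reps_stemE)
    have FG: "\<forall>z\<in>\<Omega>1 \<inter> \<Omega>2. F z = G z" and GH: "\<forall>z\<in>\<Omega>2 \<inter> \<Omega>3. G z = H z"
      using eq induced_by_eq_iff[OF F(2,3) G(2,3)] induced_by_eq_iff[OF G(2,3) H(2,3)] by auto
    have "\<forall>z\<in>\<Omega>1 \<inter> \<Omega>3. F z = H z"
    proof
      fix z assume z: "z \<in> \<Omega>1 \<inter> \<Omega>3"
      show "F z = H z"
      proof (rule eq_off_sparse_imp_eq[where f = F and g = H and S = "\<Omega>1 \<inter> \<Omega>3"])
        show "- \<Omega>2 sparse_in UNIV"
          using G(1) by (simp add: semiregular_stem_def)
        show "open (\<Omega>1 \<inter> \<Omega>3)"
          using F(1) H(1) by (intro open_Int semiregular_stem_open)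
        show "continuous_on (\<Omega>1 \<inter> \<Omega>3) F" "continuous_on (\<Omega>1 \<inter> \<Omega>3) H"
          using F(2) H(2) unfolding intrinsic_on_def
          by (meson continuous_on_subset holomorphic_on_imp_continuous_on inf_le1 inf_le2)+
      qed (use FG GH z in auto)
    qed
    then have "\<forall>q\<in>A \<inter> C. f q = h q"
      using induced_by_eq_iff[OF F(2,3) H(2,3)] by blast
    then show "(x, z) \<in> semiregular_rel UNIV"
      using reps by (simp add: semiregular_rel_def eqs)
  qed
qed (auto simp: semiregular_rel_def refl_on_def sym_def)

lemma Ms_class_eq_iff:
  "(A, f) \<in> reps \<Longrightarrow> (B, g) \<in> reps \<Longrightarrow> frac_class A f = frac_class B g \<longleftrightarrow> (\<forall>q\<in>A \<inter> B. f q = g q)"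
  unfolding Ms_class_def
  by (subst eq_equiv_class_iff[OF equiv_semiregular_rel]) (auto simp: semiregular_rel_def)

lemma Ms_class_in_Ms: "(A, f) \<in> reps \<Longrightarrow> frac_class A f \<in> Ms UNIV"
  unfolding Ms_def Ms_class_def by (rule quotientI)

lemma Ms_cases:
  assumes "X \<in> Ms UNIV"
  obtains A f where "(A, f) \<in> reps" "X = frac_class A f"
  using assms unfolding Ms_def Ms_class_def by (metis quotientE surj_pair)

lemma mem_Ms_class_iff:
  "(A, f) \<in> reps \<Longrightarrow> (B, g) \<in> frac_class A f \<longleftrightarrow> (B, g) \<in> reps \<and> (\<forall>q\<in>A \<inter> B. f q = g q)"
  by (auto simp: Ms_class_def semiregular_rel_def)

lemma intrinsic_on_real: "intrinsic_on UNIV (\<lambda>_. of_real r)"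
  by (simp add: intrinsic_on_def)

text \<open>A pointwise operation \<open>qop\<close> on quaternions that restricts on every slice to a complex operation
  \<open>cop\<close> can be carried out on the complex functions, where closure under \<open>cop\<close> is known.\<close>

lemma reps_binop:
  assumes f: "(A, f) \<in> reps" and g: "(B, g) \<in> reps"
    and hol: "\<And>F G \<Omega>. F holomorphic_on \<Omega> \<Longrightarrow> G holomorphic_on \<Omega> \<Longrightarrow> (\<lambda>z. cop (F z) (G z)) holomorphic_on \<Omega>"
    and mero: "\<And>F G. F meromorphic_on UNIV \<Longrightarrow> G meromorphic_on UNIV \<Longrightarrow>
      (\<lambda>z. cop (F z) (G z)) meromorphic_on UNIV"
    and cnj: "\<And>z w. cop (cnj z) (cnj w) = cnj (cop z w)"
    and emb: "\<And>I z w. I \<in> imag_units \<Longrightarrow>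
      qop (slice_embed I z) (slice_embed I w) = slice_embed I (cop z w)"
  shows "(A \<inter> B, \<lambda>q. qop (f q) (g q)) \<in> reps"
proof -
  obtain \<Omega> F where F: "semiregular_stem \<Omega> F" "induced_by \<Omega> F A f"
    using f by (rule reps_stemE)
  obtain \<Omega>' G where G: "semiregular_stem \<Omega>' G" "induced_by \<Omega>' G B g"
    using g by (rule reps_stemE)
  have "semiregular_stem (\<Omega> \<inter> \<Omega>') (\<lambda>z. cop (F z) (G z))"
    using F(1) G(1) unfolding semiregular_stem_def intrinsic_on_def
    by (auto simp: cnj intro!: mero hol sparse_in_union' elim: holomorphic_on_subset)
  moreover have "induced_by (\<Omega> \<inter> \<Omega>') (\<lambda>z. cop (F z) (G z)) (A \<inter> B) (\<lambda>q. qop (f q) (g q))"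
    using F(2) G(2) by (auto simp: induced_by_def emb)
  ultimately show ?thesis
    by (rule stem_imp_semiregular_reps)
qed

lemma reps_add:
  assumes "(A, f) \<in> reps" "(B, g) \<in> reps"
  shows "(A \<inter> B, \<lambda>q. f q + g q) \<in> reps"
  using assms
  by (rule reps_binop[where cop = "(+)" and qop = "(+)"])
    (simp_all add: slice_embed_add holomorphic_on_add meromorphic_on_add)

lemma reps_mult:
  assumes "(A, f) \<in> reps" "(B, g) \<in> reps"
  shows "(A \<inter> B, \<lambda>q. f q * g q) \<in> reps"
  using assms
  by (rule reps_binop[where cop = "(*)" and qop = "(*)"])
    (simp_all add: slice_embed_mult holomorphic_on_mult meromorphic_on_mult)

lemma reps_uminus:
  assumes "(A, f) \<in> reps"
  shows "(A, \<lambda>q. - f q) \<in> reps"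
proof -
  have "(A \<inter> A, \<lambda>q. - f q) \<in> reps"
    using assms assms
    by (rule reps_binop[where cop = "\<lambda>z w. - z" and qop = "\<lambda>p q. - p"])
      (simp_all add: slice_embed_uminus holomorphic_on_minus meromorphic_on_uminus)
  then show ?thesis
    by simp
qed

lemma entire_stem: "intrinsic_on UNIV F \<Longrightarrow> semiregular_stem UNIV F"
  by (auto simp: semiregular_stem_def intrinsic_on_def analytic_on_open
      intro!: analytic_on_imp_meromorphic_on)

lemma reps_entire:
  assumes "intrinsic_on UNIV F" "\<And>I z. I \<in> imag_units \<Longrightarrow> f (slice_embed I z) = slice_embed I (F z)"
  shows "(UNIV, f) \<in> reps"
  by (rule stem_imp_semiregular_reps[OF entire_stem[OF assms(1)]]) (simp add: induced_by_def assms(2))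

lemma reps_of_real: "(UNIV, \<lambda>_. of_real r) \<in> reps"
  by (rule reps_entire[OF intrinsic_on_real[of r]]) (simp add: quat_eq_iff)

lemma reps_0: "(UNIV, \<lambda>_. 0) \<in> reps" and reps_1: "(UNIV, \<lambda>_. 1) \<in> reps"
  using reps_of_real[of 0] reps_of_real[of 1] by simp_all

lemma reps_commute:
  assumes "(A, f) \<in> reps" "(B, g) \<in> reps" "q \<in> A" "q \<in> B"
  shows "f q * g q = g q * f q"
proof -
  obtain \<Omega> F where F: "intrinsic_on \<Omega> F" "induced_by \<Omega> F A f"
    using assms(1) by (rule reps_stemE)
  obtain \<Omega>' G where G: "intrinsic_on \<Omega>' G" "induced_by \<Omega>' G B g"
    using assms(2) by (rule reps_stemE)
  obtain I z where I: "I \<in> imag_units" and q: "q = slice_embed I z"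
    by (rule quat_cases_slice)
  have "f q = slice_embed I (F z)" "g q = slice_embed I (G z)"
    using F G assms(3,4) I induced_by_mem_iff[OF F I] induced_by_mem_iff[OF G I]
    by (auto simp: induced_by_def q)
  then show ?thesis
    by (simp add: mult.commute flip: slice_embed_mult[OF I])
qed

text \<open>A nonzero meromorphic function vanishes on a sparse set only; the inverse is defined after
  removing it from the domain.\<close>

lemma reps_inverse:
  assumes f: "(A, f) \<in> reps" and nz: "frac_class A f \<noteq> frac_class UNIV (\<lambda>_. 0)"
  shows "\<exists>B g. (B, g) \<in> reps \<and> (\<forall>q\<in>A \<inter> B. f q * g q = 1)"
proof -
  obtain \<Omega> F where F: "semiregular_stem \<Omega> F" "intrinsic_on \<Omega> F" "induced_by \<Omega> F A f"
    using f by (rule reps_stemE)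
  have mero: "F meromorphic_on UNIV" and sp: "- \<Omega> sparse_in UNIV"
    using F(1) by (auto simp: semiregular_stem_def)
  have zero: "intrinsic_on UNIV (\<lambda>_. 0)" "induced_by UNIV (\<lambda>_. 0) UNIV (\<lambda>_. 0)"
    using intrinsic_on_real[of 0] by (auto simp: induced_by_def)
  have "\<not> (\<forall>z\<in>\<Omega>. F z = 0)"
    using nz induced_by_eq_iff[OF F(2,3) zero] by (auto simp: Ms_class_eq_iff[OF f reps_0])
  moreover have "\<forall>z\<in>\<Omega>. F z = 0" if *: "\<forall>\<^sub>\<approx>z\<in>UNIV. F z = 0"
  proof
    fix z assume "z \<in> \<Omega>"
    show "F z = 0"
    proof (rule eq_off_sparse_imp_eq[where f = F and g = "\<lambda>_. 0" and S = \<Omega> and \<Omega> = "{z. F z = 0}"])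
      show "- {z. F z = 0} sparse_in UNIV"
        using * by (simp add: eventually_cosparse Collect_neg_eq)
      show "continuous_on \<Omega> F"
        using F(2) by (auto simp: intrinsic_on_def intro: holomorphic_on_imp_continuous_on)
    qed (use semiregular_stem_open[OF F(1)] \<open>z \<in> \<Omega>\<close> in auto)
  qed
  ultimately have "\<forall>\<^sub>\<approx>z\<in>UNIV. F z \<noteq> 0"
    using meromorphic_imp_constant_or_avoid[OF mero open_UNIV connected_UNIV, of 0] by blast
  then have "{z. F z = 0} sparse_in UNIV"
    by (simp add: eventually_cosparse)
  then have "- \<Omega> \<union> {z. F z = 0} sparse_in UNIV"
    using sp by (intro sparse_in_union')
  moreover define \<Omega>' where "\<Omega>' = \<Omega> \<inter> {z. F z \<noteq> 0}"
  have "- \<Omega>' = - \<Omega> \<union> {z. F z = 0}"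
    by (auto simp: \<Omega>'_def)
  ultimately have sp': "- \<Omega>' sparse_in UNIV"
    by simp
  have intr: "intrinsic_on \<Omega>' (\<lambda>z. inverse (F z))"
    using F(2) unfolding intrinsic_on_def \<Omega>'_def
    by (auto intro!: holomorphic_on_inverse elim: holomorphic_on_subset)
  have stem: "semiregular_stem \<Omega>' (\<lambda>z. inverse (F z))"
    using sp' intr mero by (simp add: semiregular_stem_def meromorphic_on_inverse)
  define g where "g = slice_lift (\<lambda>z. inverse (F z))"
  let ?B = "half_coord -` \<Omega>'"
  have g: "induced_by \<Omega>' (\<lambda>z. inverse (F z)) ?B g"
    unfolding g_def by (rule induced_by_slice_lift[OF intr])
  have "f q * g q = 1" if "q \<in> ?B" for q
  proof -
    obtain I z where I: "I \<in> imag_units" and q: "q = slice_embed I z"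
      by (rule quat_cases_slice)
    have "z \<in> \<Omega>'"
      using that induced_by_mem_iff[OF intr g I] q by blast
    then have "f q = slice_embed I (F z)" "g q = slice_embed I (inverse (F z))" "F z \<noteq> 0"
      using F(3) g I by (auto simp: induced_by_def q \<Omega>'_def)
    then show ?thesis
      by (simp flip: slice_embed_mult[OF I])
  qed
  then show ?thesis
    using stem_imp_semiregular_reps[OF stem g] by blast
qed

text \<open>The ring operations take the union over all representatives of both arguments. All of them
  yield the same class, so the union is that class.\<close>

lemma Ms_class_binop:
  assumes f: "(A, f) \<in> reps" and g: "(B, g) \<in> reps"
    and closed: "\<And>A f B g. (A, f) \<in> reps \<Longrightarrow> (B, g) \<in> reps \<Longrightarrow> (A \<inter> B, \<lambda>q. op (f q) (g q)) \<in> reps"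
  shows "(\<Union>(A, f)\<in>frac_class A f. \<Union>(B, g)\<in>frac_class B g. frac_class (A \<inter> B) (\<lambda>q. op (f q) (g q))) =
    frac_class (A \<inter> B) (\<lambda>q. op (f q) (g q))"
proof -
  have self: "(A, f) \<in> frac_class A f" "(B, g) \<in> frac_class B g"
    using f g by (simp_all add: mem_Ms_class_iff)
  have eq: "frac_class (A' \<inter> B') (\<lambda>q. op (f' q) (g' q)) = frac_class (A \<inter> B) (\<lambda>q. op (f q) (g q))"
    if "(A', f') \<in> frac_class A f" "(B', g') \<in> frac_class B g" for A' f' B' g'
  proof -
    have "(A', f') \<in> reps" "(B', g') \<in> reps" "\<forall>q\<in>A \<inter> A'. f q = f' q" "\<forall>q\<in>B \<inter> B'. g q = g' q"
      using that f g by (auto simp: mem_Ms_class_iff)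
    then show ?thesis
      using f g by (subst Ms_class_eq_iff) (auto intro: closed)
  qed
  show ?thesis
    by (rule UN_constant_eq[OF self(1)]) (auto intro!: UN_constant_eq[OF self(2)] simp: eq)
qed

lemma Ms_ring_sel [simp]:
  "carrier (Ms_ring UNIV) = Ms UNIV"
  "\<zero>\<^bsub>Ms_ring UNIV\<^esub> = frac_class UNIV (\<lambda>_. 0)"
  "\<one>\<^bsub>Ms_ring UNIV\<^esub> = frac_class UNIV (\<lambda>_. 1)"
  by (simp_all add: Ms_ring_def)

lemma Ms_add [simp]:
  "(A, f) \<in> reps \<Longrightarrow> (B, g) \<in> reps \<Longrightarrow>
    frac_class A f \<oplus>\<^bsub>Ms_ring UNIV\<^esub> frac_class B g = frac_class (A \<inter> B) (\<lambda>q. f q + g q)"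
  using Ms_class_binop[of A f B g "(+)"] by (simp add: Ms_ring_def reps_add)

lemma Ms_mult [simp]:
  "(A, f) \<in> reps \<Longrightarrow> (B, g) \<in> reps \<Longrightarrow>
    frac_class A f \<otimes>\<^bsub>Ms_ring UNIV\<^esub> frac_class B g = frac_class (A \<inter> B) (\<lambda>q. f q * g q)"
  using Ms_class_binop[of A f B g "(*)"] by (simp add: Ms_ring_def reps_mult)

lemmas reps_intros = reps_0 reps_1 reps_add reps_mult reps_uminus

lemma cring_Ms: "cring (Ms_ring UNIV)"
proof (intro cringI abelian_groupI comm_monoidI)
  fix X Y Z assume "X \<in> carrier (Ms_ring UNIV)" "Y \<in> carrier (Ms_ring UNIV)" "Z \<in> carrier (Ms_ring UNIV)"
  then obtain A f B g C h where [simp]: "X = frac_class A f" "Y = frac_class B g" "Z = frac_class C h"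
    and [simp]: "(A, f) \<in> reps" "(B, g) \<in> reps" "(C, h) \<in> reps"
    by (simp; metis Ms_cases)
  show "X \<oplus>\<^bsub>Ms_ring UNIV\<^esub> Y \<in> carrier (Ms_ring UNIV)" "X \<otimes>\<^bsub>Ms_ring UNIV\<^esub> Y \<in> carrier (Ms_ring UNIV)"
    by (simp_all add: Ms_class_in_Ms reps_intros)
  show "X \<oplus>\<^bsub>Ms_ring UNIV\<^esub> Y \<oplus>\<^bsub>Ms_ring UNIV\<^esub> Z = X \<oplus>\<^bsub>Ms_ring UNIV\<^esub> (Y \<oplus>\<^bsub>Ms_ring UNIV\<^esub> Z)"
    by (simp add: reps_intros Int_assoc add.assoc)
  show "X \<otimes>\<^bsub>Ms_ring UNIV\<^esub> Y \<otimes>\<^bsub>Ms_ring UNIV\<^esub> Z = X \<otimes>\<^bsub>Ms_ring UNIV\<^esub> (Y \<otimes>\<^bsub>Ms_ring UNIV\<^esub> Z)"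
    by (simp add: reps_intros Int_assoc mult.assoc)
  show "X \<oplus>\<^bsub>Ms_ring UNIV\<^esub> Y = Y \<oplus>\<^bsub>Ms_ring UNIV\<^esub> X"
    by (simp add: Int_commute add.commute)
  show "X \<otimes>\<^bsub>Ms_ring UNIV\<^esub> Y = Y \<otimes>\<^bsub>Ms_ring UNIV\<^esub> X"
    using reps_commute[of A f B g] by (simp add: Ms_class_eq_iff reps_intros)
  show "\<zero>\<^bsub>Ms_ring UNIV\<^esub> \<oplus>\<^bsub>Ms_ring UNIV\<^esub> X = X" "\<one>\<^bsub>Ms_ring UNIV\<^esub> \<otimes>\<^bsub>Ms_ring UNIV\<^esub> X = X"
    by (simp_all add: reps_intros)
  have "(A, \<lambda>_. 0) \<in> reps"
    using reps_mult[of A f UNIV "\<lambda>_. 0"] by (simp add: reps_0)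
  then show "\<exists>Y\<in>carrier (Ms_ring UNIV). Y \<oplus>\<^bsub>Ms_ring UNIV\<^esub> X = \<zero>\<^bsub>Ms_ring UNIV\<^esub>"
    by (intro bexI[of _ "frac_class A (\<lambda>q. - f q)"])
      (simp_all add: reps_intros Ms_class_in_Ms Ms_class_eq_iff)
  show "(X \<oplus>\<^bsub>Ms_ring UNIV\<^esub> Y) \<otimes>\<^bsub>Ms_ring UNIV\<^esub> Z = X \<otimes>\<^bsub>Ms_ring UNIV\<^esub> Z \<oplus>\<^bsub>Ms_ring UNIV\<^esub> Y \<otimes>\<^bsub>Ms_ring UNIV\<^esub> Z"
  proof -
    have "A \<inter> C \<inter> (B \<inter> C) = A \<inter> B \<inter> C"
      by blast
    then show ?thesis
      by (simp add: reps_intros distrib_right)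
  qed
qed (simp_all add: Ms_class_in_Ms reps_intros)

lemma field_Ms: "field (Ms_ring UNIV)"
proof (rule cring.cring_fieldI2[OF cring_Ms])
  show "\<zero>\<^bsub>Ms_ring UNIV\<^esub> \<noteq> \<one>\<^bsub>Ms_ring UNIV\<^esub>"
    by (simp add: Ms_class_eq_iff reps_intros)
  fix X assume X: "X \<in> carrier (Ms_ring UNIV)" "X \<noteq> \<zero>\<^bsub>Ms_ring UNIV\<^esub>"
  obtain A f where f: "(A, f) \<in> reps" "X = frac_class A f"
    using X(1) unfolding Ms_ring_sel by (rule Ms_cases)
  have "frac_class A f \<noteq> frac_class UNIV (\<lambda>_. 0)"
    using X(2) f(2) by simp
  from reps_inverse[OF f(1) this] obtain B g where g: "(B, g) \<in> reps" "\<forall>q\<in>A \<inter> B. f q * g q = 1"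
    by blast
  then have "X \<otimes>\<^bsub>Ms_ring UNIV\<^esub> frac_class B g = \<one>\<^bsub>Ms_ring UNIV\<^esub>"
    using f by (simp add: Ms_class_eq_iff reps_intros)
  then show "\<exists>Y\<in>carrier (Ms_ring UNIV). X \<otimes>\<^bsub>Ms_ring UNIV\<^esub> Y = \<one>\<^bsub>Ms_ring UNIV\<^esub>"
    using g Ms_class_in_Ms by auto
qed

section \<open>Quotients of slice preserving regular functions\<close>

lemma Os_iff_reps: "f \<in> Os UNIV \<longleftrightarrow> (UNIV, f) \<in> reps"
proof -
  have "symmetric_slice_domain UNIV"
    using reps_0 by (simp add: semiregular_reps_def)
  then show ?thesis
    by (simp add: Os_def semiregular_reps_def extensional_def)
qed

lemma Os_ring_sel [simp]:
  "carrier (Os_ring UNIV) = Os UNIV"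
  "\<zero>\<^bsub>Os_ring UNIV\<^esub> = (\<lambda>_. 0)" "\<one>\<^bsub>Os_ring UNIV\<^esub> = (\<lambda>_. 1)"
  "f \<oplus>\<^bsub>Os_ring UNIV\<^esub> g = (\<lambda>q. f q + g q)" "f \<otimes>\<^bsub>Os_ring UNIV\<^esub> g = (\<lambda>q. f q * g q)"
  by (simp_all add: Os_ring_def restrict_def)

lemma Os_entireE:
  assumes "f \<in> Os UNIV"
  obtains F where "intrinsic_on UNIV F" "induced_by UNIV F UNIV f"
proof -
  obtain \<Omega> F where F: "intrinsic_on \<Omega> F" "induced_by \<Omega> F UNIV f"
    using assms unfolding Os_iff_reps by (rule reps_stemE)
  have "\<Omega> = UNIV"
    using induced_by_mem_iff[OF F std_unit_in_imag_units] by auto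
  then show thesis
    using F that by blast
qed

lemma Os_intros:
  "(\<lambda>_. 0) \<in> Os UNIV" "(\<lambda>_. 1) \<in> Os UNIV"
  "f \<in> Os UNIV \<Longrightarrow> g \<in> Os UNIV \<Longrightarrow> (\<lambda>q. f q + g q) \<in> Os UNIV"
  "f \<in> Os UNIV \<Longrightarrow> g \<in> Os UNIV \<Longrightarrow> (\<lambda>q. f q * g q) \<in> Os UNIV"
  "f \<in> Os UNIV \<Longrightarrow> (\<lambda>q. - f q) \<in> Os UNIV"
  using reps_add[of UNIV f UNIV g] reps_mult[of UNIV f UNIV g]
  by (simp_all add: Os_iff_reps reps_intros)

lemma cring_Os: "cring (Os_ring UNIV)"
proof (intro cringI abelian_groupI comm_monoidI)
  fix f assume "f \<in> carrier (Os_ring UNIV)"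
  then show "\<exists>g\<in>carrier (Os_ring UNIV). g \<oplus>\<^bsub>Os_ring UNIV\<^esub> f = \<zero>\<^bsub>Os_ring UNIV\<^esub>"
    by (intro bexI[of _ "\<lambda>q. - f q"]) (simp_all add: Os_intros)
next
  fix f g assume "f \<in> carrier (Os_ring UNIV)" "g \<in> carrier (Os_ring UNIV)"
  then show "f \<otimes>\<^bsub>Os_ring UNIV\<^esub> g = g \<otimes>\<^bsub>Os_ring UNIV\<^esub> f"
    by (auto simp: fun_eq_iff Os_iff_reps intro: reps_commute)
qed (auto simp: Os_intros fun_eq_iff algebra_simps)

lemma domain_Os: "domain (Os_ring UNIV)"
proof (intro domain.intro cring_Os domain_axioms.intro)
  show "\<one>\<^bsub>Os_ring UNIV\<^esub> \<noteq> \<zero>\<^bsub>Os_ring UNIV\<^esub>"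
    by (simp add: fun_eq_iff)
  fix f g
  assume f: "f \<in> carrier (Os_ring UNIV)" and g: "g \<in> carrier (Os_ring UNIV)"
    and fg: "f \<otimes>\<^bsub>Os_ring UNIV\<^esub> g = \<zero>\<^bsub>Os_ring UNIV\<^esub>"
  obtain F where F: "intrinsic_on UNIV F" "induced_by UNIV F UNIV f"
    using f by (auto elim: Os_entireE)
  obtain G where G: "intrinsic_on UNIV G" "induced_by UNIV G UNIV g"
    using g by (auto elim: Os_entireE)
  have "F z * G z = 0" for z
  proof -
    have "slice_embed std_unit (F z * G z) = f (slice_embed std_unit z) * g (slice_embed std_unit z)"
      using F(2) G(2) by (simp add: induced_by_def slice_embed_mult)
    also have "\<dots> = 0"
      using fg by (simp add: fun_eq_iff)
    finally show ?thesis
      by simp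
  qed
  then have "(\<forall>z. F z = 0) \<or> (\<forall>z. G z = 0)"
    using F(1) G(1) by (intro holomorphic_mult_eq_0) (auto simp: intrinsic_on_def)
  moreover have "k q = 0" if "induced_by UNIV K UNIV k" "\<forall>z. K z = 0" for K k q
    using that by (cases q rule: quat_cases_slice) (auto simp: induced_by_def)
  ultimately show "f = \<zero>\<^bsub>Os_ring UNIV\<^esub> \<or> g = \<zero>\<^bsub>Os_ring UNIV\<^esub>"
    using F(2) G(2) by (auto simp: fun_eq_iff)
qed

lemma Os_to_Ms_hom: "Os_to_Ms UNIV \<in> ring_hom (Os_ring UNIV) (Ms_ring UNIV)"
  by (rule ring_hom_memI) (simp_all add: Os_to_Ms_def Os_iff_reps Ms_class_in_Ms)

lemma inj_on_Os_to_Ms: "inj_on (Os_to_Ms UNIV) (Os UNIV)"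
  by (auto simp: inj_on_def Os_to_Ms_def Os_iff_reps Ms_class_eq_iff fun_eq_iff)

lemma Ms_quotient:
  assumes "h \<in> Ms UNIV"
  shows "\<exists>f\<in>Os UNIV. \<exists>g\<in>Os UNIV. \<not> (\<exists>q. f q = 0 \<and> g q = 0) \<and> g \<noteq> \<zero>\<^bsub>Os_ring UNIV\<^esub> \<and>
    h = Os_to_Ms UNIV f \<otimes>\<^bsub>Ms_ring UNIV\<^esub> inv\<^bsub>Ms_ring UNIV\<^esub> (Os_to_Ms UNIV g)"
proof -
  interpret K: field "Ms_ring UNIV"
    by (rule field_Ms)
  obtain A k where k: "(A, k) \<in> reps" and h: "h = frac_class A k"
    using assms by (rule Ms_cases)
  obtain \<Omega> F where F: "semiregular_stem \<Omega> F" "intrinsic_on \<Omega> F" "induced_by \<Omega> F A k"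
    using k by (rule reps_stemE)
  obtain P Q where P: "intrinsic_on UNIV P" and Q: "intrinsic_on UNIV Q"
    and nz: "\<And>z. P z \<noteq> 0 \<or> Q z \<noteq> 0" and FPQ: "\<And>z. z \<in> \<Omega> \<Longrightarrow> Q z \<noteq> 0 \<and> F z = P z / Q z"
    using intrinsic_quotient[OF F(1)] by blast
  define f where "f = slice_lift P"
  define g where "g = slice_lift Q"
  have fP: "f (slice_embed I z) = slice_embed I (P z)" and gQ: "g (slice_embed I z) = slice_embed I (Q z)"
    if "I \<in> imag_units" for I z
    using induced_by_slice_lift[OF P] induced_by_slice_lift[OF Q] that
    by (auto simp: induced_by_def f_def g_def)
  have f: "f \<in> Os UNIV" and g: "g \<in> Os UNIV"
    using reps_entire[OF P fP] reps_entire[OF Q gQ] by (auto simp: Os_iff_reps)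
  have common: "f q \<noteq> 0 \<or> g q \<noteq> 0" for q
    using quat_cases_slice[of q] by (metis fP gQ nz slice_embed_eq_0_iff)
  have kg: "k q * g q = f q" if "q \<in> A" for q
  proof -
    obtain I z where I: "I \<in> imag_units" and q: "q = slice_embed I z"
      by (rule quat_cases_slice)
    have "z \<in> \<Omega>"
      using that induced_by_mem_iff[OF F(2,3) I] q by blast
    then have "k q = slice_embed I (F z)"
      using F(3) I by (simp add: induced_by_def q)
    then have "k q * g q = slice_embed I (F z * Q z)"
      by (simp add: q gQ[OF I] slice_embed_mult[OF I])
    also have "\<dots> = f q"
      using FPQ[OF \<open>z \<in> \<Omega>\<close>] by (simp add: q fP[OF I])
    finally show ?thesis .
  qed
  have "A \<noteq> {}"
    using k by (simp add: semiregular_reps_def symmetric_slice_domain_def)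
  have g0: "g \<noteq> (\<lambda>_. 0)"
  proof
    assume "g = (\<lambda>_. 0)"
    then show False
      using kg common \<open>A \<noteq> {}\<close> by fastforce
  qed
  let ?f = "Os_to_Ms UNIV f" and ?g = "Os_to_Ms UNIV g"
  have mem: "?f \<in> Ms UNIV" "?g \<in> Ms UNIV"
    using f g by (simp_all add: Os_to_Ms_def Os_iff_reps Ms_class_in_Ms)
  have "?g \<noteq> \<zero>\<^bsub>Ms_ring UNIV\<^esub>"
    using inj_on_eq_iff[OF inj_on_Os_to_Ms g Os_intros(1)] g0 by (simp add: Os_to_Ms_def)
  then have unit: "?g \<in> Units (Ms_ring UNIV)"
    using mem by (simp add: K.field_Units)
  have "h \<otimes>\<^bsub>Ms_ring UNIV\<^esub> ?g = ?f"
    using k f g kg reps_mult[of A k UNIV g]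
    by (simp add: h Os_to_Ms_def Os_iff_reps Ms_class_eq_iff)
  then have "?f \<otimes>\<^bsub>Ms_ring UNIV\<^esub> inv\<^bsub>Ms_ring UNIV\<^esub> ?g = h \<otimes>\<^bsub>Ms_ring UNIV\<^esub> (?g \<otimes>\<^bsub>Ms_ring UNIV\<^esub> inv\<^bsub>Ms_ring UNIV\<^esub> ?g)"
    using assms mem K.Units_inv_closed[OF unit] by (subst K.m_assoc[symmetric]) auto
  then have "h = ?f \<otimes>\<^bsub>Ms_ring UNIV\<^esub> inv\<^bsub>Ms_ring UNIV\<^esub> ?g"
    using assms unit K.r_one[of h] by simp
  then show ?thesis
    using f g g0 common by (intro bexI[of _ f] bexI[of _ g]) auto
qed

theorem theorem4p8:
  shows "quotient_field_via (Os_ring UNIV) (Ms_ring UNIV) (Os_to_Ms UNIV) \<and>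
    (\<forall>h\<in>Ms UNIV. \<exists>f\<in>Os UNIV. \<exists>g\<in>Os UNIV.
       \<not> (\<exists>q. f q = 0 \<and> g q = 0) \<and>
       g \<noteq> \<zero>\<^bsub>Os_ring UNIV\<^esub> \<and>
       h = Os_to_Ms UNIV f \<otimes>\<^bsub>Ms_ring UNIV\<^esub> inv\<^bsub>Ms_ring UNIV\<^esub> (Os_to_Ms UNIV g))"
proof (intro conjI ballI Ms_quotient)
  have "\<exists>f\<in>Os UNIV. \<exists>g\<in>Os UNIV - {\<zero>\<^bsub>Os_ring UNIV\<^esub>}.
      h = Os_to_Ms UNIV f \<otimes>\<^bsub>Ms_ring UNIV\<^esub> inv\<^bsub>Ms_ring UNIV\<^esub> (Os_to_Ms UNIV g)"
    if "h \<in> Ms UNIV" for h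
    using Ms_quotient[OF that] by blast
  then show "quotient_field_via (Os_ring UNIV) (Ms_ring UNIV) (Os_to_Ms UNIV)"
    unfolding quotient_field_via_def
    using domain_Os field_Ms Os_to_Ms_hom inj_on_Os_to_Ms by simp
qed

end
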